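(* (1) The triple $(\mathcal{T}_\bullet,\overline{\ast},\hat{\delta})$ is a graded connected cocommutative Hopf algebra (with unit the empty set composition and counit the projection onto $\mathcal{T}_0$). (2) The triple $(\mathcal{T}_\bullet,\hat{\ast},\overline{\delta})$ is a graded connected Hopf algebra, and it is isomorphic to the graded dual $\mathsf{NCQsym}^*$ of the Hopf algebra $\mathsf{NCQsym}$ of quasi-symmetric functions in non-commuting variables; an isomorphism is given by sending each set composition $P$ to the element $W_P$ of the basis of $\mathsf{NCQsym}^*$ dual to the basis $(M_P)$ of $\mathsf{NCQsym}$.
   Context: For a finite set $S\subset\mathbb{N}$, a set composition of $S$ is a tuple $(P_1,\ldots,P_k)$ of pairwise disjoint non-empty subsets of $S$ with union $S$; $\mathsf{Comp}_n$ is the set of set compositions of $[n]=\{1,\ldots,n\}$ ($[0]=\emptyset$, $\mathsf{Comp}_0$ consists of the empty tuple). $\mathcal{T}_n$ is the free $\mathbb{Z}$-module on $\mathsf{Comp}_n$ and $\mathcal{T}_\bullet=\bigoplus_{n\ge0}\mathcal{T}_n$, graded by $n$. For finite $S,T\subset\mathbb{N}$ with $|S|=|T|$, $\mathsf{is}_{S,T}$ maps a set composition of $S$ to a set composition of $T$ by applying the unique order-preserving bijection $S\to T$ to each block; $\mathsf{is}_S=\mathsf{is}_{S,[|S|]}$. For $P=(P_1,\ldots,P_k)\in\mathsf{Comp}_n$ and $A\subseteq[n]$, $P|_A=\mathsf{is}_A((P_1\cap A,\ldots,P_k\cap A)^\#)$, where $^\#$ deletes empty entries. For set compositions $P$ of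 $S$ and $Q$ of $T$ with $S\cap T=\emptyset$, $P\ast Q$ is the concatenated tuple. Write $p+X=\{p+x:x\in X\}$. Products and coproducts (extended linearly): for $P=(P_1,\ldots,P_k)\in\mathsf{Comp}_p$, $Q=(Q_1,\ldots,Q_l)\in\mathsf{Comp}_q$: $P\,\overline{\ast}\,Q=(P_1,\ldots,P_k,p+Q_1,\ldots,p+Q_l)$; $P\,\hat{\ast}\,Q=\sum \mathsf{is}_{[p],A}(P)\ast\mathsf{is}_{[q],B}(Q)$, summed over all ordered pairs $(A,B)$ with $A\sqcup B=[p+q]$, $|A|=p$, $|B|=q$. For $P\in\mathsf{Comp}_n$: $\hat{\delta}(P)=\sum_{A\sqcup B=[n]}P|_A\otimes P|_B$ (over ordered pairs, $A$ or $B$ possibly empty) and $\overline{\delta}(P)=\sum_{p+q=n}P|_{[p]}\otimes P|_{\{p+1,\ldots,p+q\}}$. $\mathsf{NCQsym}$: in the algebra of formal power series in non-commuting variables $x_1,x_2,\ldots$, for $P=(P_1,\ldots,P_k)\in\mathsf{Comp}_n$ let $M_P=\sum x_{i_1}\cdots x_{i_n}$, summed over all words with $i_j=i_{j'}$ iff $j,j'$ lie in the same block and $i_j<i_{j'}$ whenever $j\in P_r$, $j'\in P_s$, $r<s$. $\mathsf{NCQsym}$ is the graded span of the $M_P$, with the product of series and the coproduct $\Delta(M_P)=\sum_{i=0}^k M_{\mathsf{is}(P_1,\ldots,P_i)}\otimes M_{\mathsf{is}(P_{i+1},\ldots,P_k)}$ ($\mathsf{is}$ standardizing the ground set to an initial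 segment); $\mathsf{NCQsym}^*$ is its graded dual with dual basis $(W_P)$. *)

theory Defs
  imports Main "HOL-Library.Poly_Mapping"
begin

(* A free Z-module with basis B (a subset of a type 'a) is represented as the
  set of finitely supported functions x :: 'a \<Rightarrow>_0 int with keys x \<subseteq> B.
  The tensor product of two free modules with bases B1, B2 is the free module on
  B1 \<times> B2, triple tensors live on 'a \<times> 'a \<times> 'a.
  Multiplications, comultiplications, units and counits are given on basis elements
  and extended linearly (frag_extend). *)

definition tens :: "('a \<Rightarrow>\<^sub>0 int) \<Rightarrow> ('b \<Rightarrow>\<^sub>0 int) \<Rightarrow> ('a \<times> 'b) \<Rightarrow>\<^sub>0 int" where
  "tens x y = frag_extend (\<lambda>a. frag_extend (\<lambda>b. frag_of (a, b)) y) x"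

definition mult_ext :: "('a \<Rightarrow> 'a \<Rightarrow> 'a \<Rightarrow>\<^sub>0 int) \<Rightarrow> ('a \<Rightarrow>\<^sub>0 int) \<Rightarrow> ('a \<Rightarrow>\<^sub>0 int) \<Rightarrow> 'a \<Rightarrow>\<^sub>0 int" where
  "mult_ext mu x y = frag_extend (\<lambda>a. frag_extend (\<lambda>b. mu a b) y) x"

definition tensor_mult :: "('a \<Rightarrow> 'a \<Rightarrow> 'a \<Rightarrow>\<^sub>0 int) \<Rightarrow> (('a \<times> 'a) \<Rightarrow>\<^sub>0 int) \<Rightarrow> (('a \<times> 'a) \<Rightarrow>\<^sub>0 int) \<Rightarrow> ('a \<times> 'a) \<Rightarrow>\<^sub>0 int" where
  "tensor_mult mu X Y =
     frag_extend (\<lambda>(a1, a2). frag_extend (\<lambda>(b1, b2). tens (mu a1 b1) (mu a2 b2)) Y) X"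

definition counit_ext :: "('a \<Rightarrow> int) \<Rightarrow> ('a \<Rightarrow>\<^sub>0 int) \<Rightarrow> int" where
  "counit_ext eps x = (\<Sum>a\<in>Poly_Mapping.keys x. poly_mapping.lookup x a * eps a)"

definition hopf_algebra ::
  "'a set \<Rightarrow> 'a \<Rightarrow> ('a \<Rightarrow> 'a \<Rightarrow> 'a \<Rightarrow>\<^sub>0 int) \<Rightarrow> ('a \<Rightarrow> ('a \<times> 'a) \<Rightarrow>\<^sub>0 int) \<Rightarrow> ('a \<Rightarrow> int) \<Rightarrow> bool" where
  "hopf_algebra B e mu delta eps \<longleftrightarrow>
     e \<in> B \<and>
     (\<forall>a\<in>B. \<forall>b\<in>B. Poly_Mapping.keys (mu a b) \<subseteq> B) \<and>
     (\<forall>a\<in>B. Poly_Mapping.keys (delta a) \<subseteq> B \<times> B) \<and>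
     \<comment> \<open>associativity\<close>
     (\<forall>a\<in>B. \<forall>b\<in>B. \<forall>c\<in>B. mult_ext mu (mu a b) (frag_of c) = mult_ext mu (frag_of a) (mu b c)) \<and>
     \<comment> \<open>unit\<close>
     (\<forall>a\<in>B. mu e a = frag_of a \<and> mu a e = frag_of a) \<and>
     \<comment> \<open>coassociativity\<close>
     (\<forall>a\<in>B. frag_extend (\<lambda>(b, c). frag_extend (\<lambda>(b1, b2). frag_of (b1, b2, c)) (delta b)) (delta a)
           = frag_extend (\<lambda>(b, c). frag_extend (\<lambda>(c1, c2). frag_of (b, c1, c2)) (delta c)) (delta a)) \<and>
     \<comment> \<open>counit\<close>
     (\<forall>a\<in>B. frag_extend (\<lambda>(b, c). frag_cmul (eps b) (frag_of c)) (delta a) = frag_of a \<and>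
            frag_extend (\<lambda>(b, c). frag_cmul (eps c) (frag_of b)) (delta a) = frag_of a) \<and>
     \<comment> \<open>coproduct and counit are algebra morphisms\<close>
     (\<forall>a\<in>B. \<forall>b\<in>B. frag_extend delta (mu a b) = tensor_mult mu (delta a) (delta b)) \<and>
     delta e = frag_of (e, e) \<and>
     (\<forall>a\<in>B. \<forall>b\<in>B. counit_ext eps (mu a b) = eps a * eps b) \<and>
     eps e = 1 \<and>
     \<comment> \<open>existence of an antipode\<close>
     (\<exists>S :: 'a \<Rightarrow> 'a \<Rightarrow>\<^sub>0 int. (\<forall>a\<in>B. Poly_Mapping.keys (S a) \<subseteq> B) \<and>
        (\<forall>a\<in>B. frag_extend (\<lambda>(b, c). mult_ext mu (S b) (frag_of c)) (delta a) = frag_cmul (eps a) (frag_of e) \<and>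
               frag_extend (\<lambda>(b, c). mult_ext mu (frag_of b) (S c)) (delta a) = frag_cmul (eps a) (frag_of e)))"

definition graded_connected ::
  "'a set \<Rightarrow> 'a \<Rightarrow> ('a \<Rightarrow> 'a \<Rightarrow> 'a \<Rightarrow>\<^sub>0 int) \<Rightarrow> ('a \<Rightarrow> ('a \<times> 'a) \<Rightarrow>\<^sub>0 int) \<Rightarrow> ('a \<Rightarrow> int) \<Rightarrow> ('a \<Rightarrow> nat) \<Rightarrow> bool" where
  "graded_connected B e mu delta eps deg \<longleftrightarrow>
     deg e = 0 \<and>
     (\<forall>a\<in>B. \<forall>b\<in>B. \<forall>c\<in>Poly_Mapping.keys (mu a b). deg c = deg a + deg b) \<and>
     (\<forall>a\<in>B. \<forall>(b, c)\<in>Poly_Mapping.keys (delta a). deg b + deg c = deg a) \<and>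
     (\<forall>a\<in>B. deg a \<noteq> 0 \<longrightarrow> eps a = 0) \<and>
     {b\<in>B. deg b = 0} = {e}"

definition cocommutative :: "'a set \<Rightarrow> ('a \<Rightarrow> ('a \<times> 'a) \<Rightarrow>\<^sub>0 int) \<Rightarrow> bool" where
  "cocommutative B delta \<longleftrightarrow> (\<forall>a\<in>B. frag_extend (\<lambda>(b, c). frag_of (c, b)) (delta a) = delta a)"

definition hopf_iso ::
  "'a set \<Rightarrow> 'a \<Rightarrow> ('a \<Rightarrow> 'a \<Rightarrow> 'a \<Rightarrow>\<^sub>0 int) \<Rightarrow> ('a \<Rightarrow> ('a \<times> 'a) \<Rightarrow>\<^sub>0 int) \<Rightarrow> ('a \<Rightarrow> int) \<Rightarrow>
   'b set \<Rightarrow> 'b \<Rightarrow> ('b \<Rightarrow> 'b \<Rightarrow> 'b \<Rightarrow>\<^sub>0 int) \<Rightarrow> ('b \<Rightarrow> ('b \<times> 'b) \<Rightarrow>\<^sub>0 int) \<Rightarrow> ('b \<Rightarrow> int) \<Rightarrow>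
   ('a \<Rightarrow> 'b \<Rightarrow>\<^sub>0 int) \<Rightarrow> bool" where
  "hopf_iso B1 e1 mu1 delta1 eps1 B2 e2 mu2 delta2 eps2 f \<longleftrightarrow>
     bij_betw (frag_extend f) {x. Poly_Mapping.keys x \<subseteq> B1} {y. Poly_Mapping.keys y \<subseteq> B2} \<and>
     (\<forall>a\<in>B1. \<forall>b\<in>B1. frag_extend f (mu1 a b) = mult_ext mu2 (f a) (f b)) \<and>
     f e1 = frag_of e2 \<and>
     (\<forall>a\<in>B1. frag_extend (\<lambda>(b, c). tens (f b) (f c)) (delta1 a) = frag_extend delta2 (f a)) \<and>
     (\<forall>a\<in>B1. counit_ext eps2 (f a) = eps1 a)"

type_synonym scomp = "nat set list"

definition is_setcomp :: "nat set \<Rightarrow> scomp \<Rightarrow> bool" where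
  "is_setcomp S P \<longleftrightarrow> (\<forall>B\<in>set P. B \<noteq> {}) \<and>
     (\<forall>i<length P. \<forall>j<length P. i \<noteq> j \<longrightarrow> P ! i \<inter> P ! j = {}) \<and> \<Union>(set P) = S"

definition Comp :: "nat \<Rightarrow> scomp set" where
  "Comp n = {P. is_setcomp {1..n} P}"

definition Comps :: "scomp set" where
  "Comps = (\<Union>n. Comp n)"

definition cdeg :: "scomp \<Rightarrow> nat" where
  "cdeg P = card (\<Union>(set P))"

(* the unique order preserving bijection S \<rightarrow> T (finite, |S| = |T|) *)
definition ord_iso :: "nat set \<Rightarrow> nat set \<Rightarrow> nat \<Rightarrow> nat" where
  "ord_iso S T x = sorted_list_of_set T ! card {y\<in>S. y < x}"

definition is_map :: "nat set \<Rightarrow> nat set \<Rightarrow> scomp \<Rightarrow> scomp" where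
  "is_map S T P = map (\<lambda>B. ord_iso S T ` B) P"

definition std :: "scomp \<Rightarrow> scomp" where
  "std P = is_map (\<Union>(set P)) {1..card (\<Union>(set P))} P"

definition restr :: "scomp \<Rightarrow> nat set \<Rightarrow> scomp" where
  "restr P A = is_map A {1..card A} (filter (\<lambda>B. B \<noteq> {}) (map (\<lambda>B. B \<inter> A) P))"

definition bar_mult :: "scomp \<Rightarrow> scomp \<Rightarrow> scomp \<Rightarrow>\<^sub>0 int" where
  "bar_mult P Q = frag_of (P @ map (\<lambda>B. (\<lambda>x. cdeg P + x) ` B) Q)"

definition hat_mult :: "scomp \<Rightarrow> scomp \<Rightarrow> scomp \<Rightarrow>\<^sub>0 int" where
  "hat_mult P Q =
     (\<Sum>A\<in>{A. A \<subseteq> {1..cdeg P + cdeg Q} \<and> card A = cdeg P}.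
        frag_of (is_map {1..cdeg P} A P @ is_map {1..cdeg Q} ({1..cdeg P + cdeg Q} - A) Q))"

definition hat_delta :: "scomp \<Rightarrow> (scomp \<times> scomp) \<Rightarrow>\<^sub>0 int" where
  "hat_delta P = (\<Sum>A\<in>Pow {1..cdeg P}. frag_of (restr P A, restr P ({1..cdeg P} - A)))"

definition bar_delta :: "scomp \<Rightarrow> (scomp \<times> scomp) \<Rightarrow>\<^sub>0 int" where
  "bar_delta P = (\<Sum>p\<in>{0..cdeg P}. frag_of (restr P {1..p}, restr P {p+1..cdeg P}))"

definition t_eps :: "scomp \<Rightarrow> int" where
  "t_eps P = (if P = [] then 1 else 0)"

(* Formal power series in non-commuting variables x_1, x_2, ... over Z:
  a series is its coefficient function on words (lists of variable indices). *)
type_synonym ncseries = "nat list \<Rightarrow> int"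

definition ser_mult :: "ncseries \<Rightarrow> ncseries \<Rightarrow> ncseries" where
  "ser_mult f g = (\<lambda>w. \<Sum>i\<le>length w. f (take i w) * g (drop i w))"

(* M_P: the word x_{i_1} ... x_{i_n} is represented as [i_1, ..., i_n], so i_j = w ! (j-1) *)
definition M :: "scomp \<Rightarrow> ncseries" where
  "M P w = (if length w = cdeg P \<and> (\<forall>j<length w. 1 \<le> w ! j) \<and>
      (\<forall>r<length P. \<forall>s<length P. \<forall>j\<in>P ! r. \<forall>j'\<in>P ! s.
          (w ! (j - 1) = w ! (j' - 1) \<longleftrightarrow> r = s) \<and> (r < s \<longrightarrow> w ! (j - 1) < w ! (j' - 1)))
    then 1 else 0)"

definition ncq_of :: "(scomp \<Rightarrow>\<^sub>0 int) \<Rightarrow> ncseries" where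
  "ncq_of y = (\<lambda>w. \<Sum>R\<in>Poly_Mapping.keys y. poly_mapping.lookup y R * M R w)"

(* coproduct of NCQsym, in the basis (M_P): M_P \<mapsto> (P,Q)-coordinates of M_P \<otimes> M_Q *)
definition ncq_delta :: "scomp \<Rightarrow> (scomp \<times> scomp) \<Rightarrow>\<^sub>0 int" where
  "ncq_delta R = (\<Sum>i\<le>length R. frag_of (std (take i R), std (drop i R)))"

(* Graded dual NCQsym^*: basis (W_P) dual to (M_P). *)
datatype dualW = W scomp

definition dual_basis :: "dualW set" where
  "dual_basis = W ` Comps"

(* product of NCQsym^*: dual to the coproduct of NCQsym,
  (W_P W_Q)(M_R) = coefficient of M_P \<otimes> M_Q in \<Delta>(M_R) *)
definition dual_mult :: "dualW \<Rightarrow> dualW \<Rightarrow> dualW \<Rightarrow>\<^sub>0 int" where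
  "dual_mult a b = (case (a, b) of (W P, W Q) \<Rightarrow>
     (\<Sum>R\<in>Comp (cdeg P + cdeg Q). frag_cmul (poly_mapping.lookup (ncq_delta R) (P, Q)) (frag_of (W R))))"

definition prod_coeff :: "scomp \<Rightarrow> scomp \<Rightarrow> scomp \<Rightarrow> int" where
  "prod_coeff P Q R = poly_mapping.lookup
     (THE y. Poly_Mapping.keys y \<subseteq> Comps \<and> ncq_of y = ser_mult (M P) (M Q)) R"

(* coproduct of NCQsym^*: dual to the product of NCQsym,
  \<Delta>(W_R)(M_P \<otimes> M_Q) = W_R(M_P M_Q) *)
definition dual_delta :: "dualW \<Rightarrow> (dualW \<times> dualW) \<Rightarrow>\<^sub>0 int" where
  "dual_delta a = (case a of W R \<Rightarrow>
     (\<Sum>(P, Q)\<in>{(P, Q). P \<in> Comps \<and> Q \<in> Comps \<and> cdeg P + cdeg Q = cdeg R}.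
        frag_cmul (prod_coeff P Q R) (frag_of (W P, W Q))))"

(* counit of NCQsym^*: evaluation at the unit 1 = M_[] of NCQsym *)
definition dual_eps :: "dualW \<Rightarrow> int" where
  "dual_eps a = (case a of W P \<Rightarrow> (if P = [] then 1 else 0))"

(* unit of NCQsym^* is W_[] (the counit M_P \<mapsto> [P = []] of NCQsym). *)

end

theory Submission
  imports Defs
begin

text \<open>
  Restricting a set composition commutes with strictly monotone relabelling. Hence both coproducts are
  sums over the splittings of the ground set belonging to a family (all subsets, respectively lower
  sets) that is stable under strictly monotone maps, which gives coassociativity. Restricting a
  concatenation of two relabelled compositions restricts both factors, which gives the compatibility
  with the products. The antipode of a graded connected bialgebra comes from recursion on the degree.

  A shuffle term \<open>R\<close> of \<open>P\<close> and \<open>Q\<close> is characterised by the fact that its first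
  \<open>length P\<close> blocks standardize to \<open>P\<close> and the remaining ones to \<open>Q\<close>; this is also
  the description of the product dual to the deconcatenation of blocks, and it makes associativity
  evident. A word has exactly one set composition \<open>R\<close> with \<open>M R\<close> nonzero on it, and
  cutting the word restricts \<open>R\<close> to an initial and a final segment, which is the coproduct dual to
  the product of series.
\<close>

subsection \<open>Graded connected bialgebras on a basis\<close>

text \<open>The obstacle is standardization: products and coproducts compose several maps
  \<open>ord_iso\<close>, which are given by counting and list lookup. A strictly monotone map on a
  finite set is determined by its image, so such a composite may be replaced by any strictly
  monotone map with the right image: the identity on an initial segment, a translation, a map
  defined piecewise. Most identities between set compositions thus reduce to naming a map and
  computing an image.

  The two forms of the shuffle product serve different ends. Indexing by the ground set
  \<open>A\<close> of the first factor allows a term to be cut at a position, as the coproduct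
  requires. Indexing by the result \<open>R\<close> shows that all coefficients are 0 or 1 and makes
  iterated products comparable. The passage between them works because \<open>A\<close> is the union
  of the first blocks of \<open>R\<close>. The structure constants of NCQsym in the basis
  \<open>M\<close> are 0 or 1 as well, so the isomorphism becomes a comparison of index
  sets.\<close>

lemma additive_zero:
  fixes \<phi> :: "'a::ab_group_add \<Rightarrow> 'b::ab_group_add"
  assumes "\<And>x y. \<phi> (x - y) = \<phi> x - \<phi> y"
  shows "\<phi> 0 = 0"
  using assms[of 0 0] by simp

lemma additive_add:
  fixes \<phi> :: "'a::ab_group_add \<Rightarrow> 'b::ab_group_add"
  assumes "\<And>x y. \<phi> (x - y) = \<phi> x - \<phi> y"
  shows "\<phi> (x + y) = \<phi> x + \<phi> y"
  using assms[of x "0 - y"] assms[of 0 y] assms[of 0 0] by simp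

lemma additive_sum:
  fixes \<phi> :: "'a::ab_group_add \<Rightarrow> 'b::ab_group_add"
  assumes "\<And>x y. \<phi> (x - y) = \<phi> x - \<phi> y"
  shows "\<phi> (sum f A) = (\<Sum>i\<in>A. \<phi> (f i))"
  by (induction A rule: infinite_finite_induct)
    (simp_all add: additive_zero[of \<phi>, OF assms] additive_add[of \<phi>, OF assms])

text \<open>Source of all interchange laws below: composition of extensions, scalars, either
  argument of \<open>mult_ext\<close>. Over the integers additivity already gives linearity, and it
  is phrased with differences because the step of \<open>frag_induction\<close> is a
  difference.\<close>

lemma additive_frag_extend:
  fixes \<phi> :: "('a \<Rightarrow>\<^sub>0 int) \<Rightarrow> ('b \<Rightarrow>\<^sub>0 int)"
  assumes "\<And>x y. \<phi> (x - y) = \<phi> x - \<phi> y"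
  shows "\<phi> (frag_extend f z) = frag_extend (\<lambda>i. \<phi> (f i)) z"
proof -
  have "Poly_Mapping.keys z \<subseteq> UNIV" by simp
  then show ?thesis
    by (induction z rule: frag_induction)
      (simp_all add: assms additive_zero[of \<phi>, OF assms] frag_extend_diff)
qed

lemma frag_extend_pair_cong:
  assumes "\<And>i j. (i, j) \<in> Poly_Mapping.keys z \<Longrightarrow> f i j = g i j"
  shows "frag_extend (\<lambda>(i, j). f i j) z = frag_extend (\<lambda>(i, j). g i j) z"
  by (rule frag_extend_eq) (use assms in auto)

lemma frag_cmul_diff_right: "frag_cmul c (x - y) = frag_cmul c x - frag_cmul c y"
  by (rule poly_mapping_eqI) (simp add: lookup_minus right_diff_distrib)

lemma frag_extend_fun_diff:
  "frag_extend (\<lambda>i. f i - g i) z = frag_extend f z - frag_extend g z"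
  unfolding frag_extend_def by (simp add: frag_cmul_diff_right sum_subtractf)

lemma frag_extend_fun_add:
  "frag_extend (\<lambda>i. f i + g i) z = frag_extend f z + frag_extend g z"
  unfolding frag_extend_def by (simp add: frag_cmul_distrib2 sum.distrib)

lemma frag_extend_frag_extend:
  "frag_extend f (frag_extend g z) = frag_extend (\<lambda>i. frag_extend f (g i)) z"
  by (rule additive_frag_extend) (rule frag_extend_diff)

lemma frag_extend_sum_of:
  "frag_extend f (\<Sum>i\<in>A. frag_of (g i)) = (\<Sum>i\<in>A. f (g i))"
  using additive_sum[of "frag_extend f" "\<lambda>i. frag_of (g i)" A] by (simp add: frag_extend_diff)

lemma keys_frag_extend_subset:
  assumes "\<And>i. i \<in> Poly_Mapping.keys z \<Longrightarrow> Poly_Mapping.keys (f i) \<subseteq> B"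
  shows "Poly_Mapping.keys (frag_extend f z) \<subseteq> B"
  using keys_frag_extend[of f z] assms by blast

lemma keys_frag_extend_pair_subset:
  assumes "\<And>i j. (i, j) \<in> Poly_Mapping.keys z \<Longrightarrow> Poly_Mapping.keys (f i j) \<subseteq> B"
  shows "Poly_Mapping.keys (frag_extend (\<lambda>(i, j). f i j) z) \<subseteq> B"
  by (rule keys_frag_extend_subset) (use assms in auto)

lemma keys_sum_frag_of: "Poly_Mapping.keys (\<Sum>i\<in>A. frag_of (g i)) \<subseteq> g ` A"
  using Poly_Mapping.keys_sum[of "\<lambda>i. frag_of (g i)" A] by (auto simp: image_iff)

lemma mult_ext_diff_left: "mult_ext mu (x - y) z = mult_ext mu x z - mult_ext mu y z"
  by (simp add: mult_ext_def frag_extend_diff)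

lemma mult_ext_diff_right: "mult_ext mu z (x - y) = mult_ext mu z x - mult_ext mu z y"
  by (simp add: mult_ext_def frag_extend_diff frag_extend_fun_diff)

lemma mult_ext_of [simp]: "mult_ext mu (frag_of a) (frag_of b) = mu a b"
  by (simp add: mult_ext_def)

lemma mult_ext_zero [simp]: "mult_ext mu 0 z = 0" "mult_ext mu z 0 = 0"
  using mult_ext_diff_left[of mu 0 0 z] mult_ext_diff_right[of mu z 0 0] by simp_all

lemma mult_ext_cmul:
  "mult_ext mu (frag_cmul k x) y = frag_cmul k (mult_ext mu x y)"
  "mult_ext mu x (frag_cmul k y) = frag_cmul k (mult_ext mu x y)"
proof -
  show "mult_ext mu (frag_cmul k x) y = frag_cmul k (mult_ext mu x y)"
    by (simp add: mult_ext_def frag_extend_cmul)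
  show "mult_ext mu x (frag_cmul k y) = frag_cmul k (mult_ext mu x y)"
    unfolding mult_ext_def frag_extend_cmul
    by (rule additive_frag_extend[of "frag_cmul k", symmetric]) (rule frag_cmul_diff_right)
qed

lemma mult_ext_frag_extend_left:
  "mult_ext mu (frag_extend f z) y = frag_extend (\<lambda>i. mult_ext mu (f i) y) z"
  by (rule additive_frag_extend) (rule mult_ext_diff_left)

lemma mult_ext_frag_extend_right:
  "mult_ext mu y (frag_extend f z) = frag_extend (\<lambda>i. mult_ext mu y (f i)) z"
  by (rule additive_frag_extend) (rule mult_ext_diff_right)

lemma tens_of [simp]: "tens (frag_of a) (frag_of b) = frag_of (a, b)"
  by (simp add: tens_def)

lemma tens_sum_of:
  "tens (\<Sum>i\<in>A. frag_of (f i)) (\<Sum>j\<in>C. frag_of (g j)) = (\<Sum>i\<in>A. \<Sum>j\<in>C. frag_of (f i, g j))"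
  by (simp add: tens_def frag_extend_sum_of)

lemma tensor_mult_sum_of:
  "tensor_mult mu (\<Sum>i\<in>A. frag_of (f i, f' i)) (\<Sum>j\<in>C. frag_of (g j, g' j)) =
    (\<Sum>i\<in>A. \<Sum>j\<in>C. tens (mu (f i) (g j)) (mu (f' i) (g' j)))"
  by (simp add: tensor_mult_def frag_extend_sum_of)

text \<open>The support of a difference can shrink by cancellation. Summing over one fixed finite
  superset of all supports involved makes additivity visible.\<close>

lemma counit_ext_superset:
  assumes "finite K" "Poly_Mapping.keys x \<subseteq> K"
  shows "counit_ext eps x = (\<Sum>a\<in>K. poly_mapping.lookup x a * eps a)"
  unfolding counit_ext_def
  by (rule sum.mono_neutral_left) (use assms in \<open>auto simp: in_keys_iff\<close>)

lemma counit_ext_diff: "counit_ext eps (x - y) = counit_ext eps x - counit_ext eps y"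
proof -
  let ?K = "Poly_Mapping.keys x \<union> Poly_Mapping.keys y"
  have "Poly_Mapping.keys (x - y) \<subseteq> ?K" by (rule keys_diff)
  then show ?thesis
    using counit_ext_superset[of ?K "x - y" eps] counit_ext_superset[of ?K x eps]
      counit_ext_superset[of ?K y eps]
    by (simp add: lookup_minus sum_subtractf left_diff_distrib)
qed

lemma counit_ext_of [simp]: "counit_ext eps (frag_of a) = eps a"
  by (simp add: counit_ext_def)

lemma counit_ext_sum_of: "counit_ext eps (\<Sum>i\<in>A. frag_of (f i)) = (\<Sum>i\<in>A. eps (f i))"
  using additive_sum[of "counit_ext eps" "\<lambda>i. frag_of (f i)" A] by (simp add: counit_ext_diff)

section \<open>Convolution and the antipode\<close>

text \<open>Convolution of linear maps from the coalgebra to the algebra, each given by its values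
  on basis elements. The identity map is \<open>frag_of\<close>, and an antipode is a two-sided
  convolution inverse of it.\<close>

definition convolution ::
  "('a \<Rightarrow> 'a \<Rightarrow> 'a \<Rightarrow>\<^sub>0 int) \<Rightarrow> ('a \<Rightarrow> ('a \<times> 'a) \<Rightarrow>\<^sub>0 int) \<Rightarrow>
    ('a \<Rightarrow> 'a \<Rightarrow>\<^sub>0 int) \<Rightarrow> ('a \<Rightarrow> 'a \<Rightarrow>\<^sub>0 int) \<Rightarrow> 'a \<Rightarrow> 'a \<Rightarrow>\<^sub>0 int" where
  "convolution mu delta f g a = frag_extend (\<lambda>(b, c). mult_ext mu (f b) (g c)) (delta a)"

text \<open>Collects the axioms of both target predicates apart from the antipode, so that the
  antipode is constructed once for the two structures on set compositions.\<close>

locale graded_connected_bialgebra =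
  fixes B :: "'a set" and e :: 'a and mu :: "'a \<Rightarrow> 'a \<Rightarrow> 'a \<Rightarrow>\<^sub>0 int"
    and delta :: "'a \<Rightarrow> ('a \<times> 'a) \<Rightarrow>\<^sub>0 int" and eps :: "'a \<Rightarrow> int" and deg :: "'a \<Rightarrow> nat"
  assumes unit_mem: "e \<in> B"
    and mult_mem: "\<And>a b. a \<in> B \<Longrightarrow> b \<in> B \<Longrightarrow> Poly_Mapping.keys (mu a b) \<subseteq> B"
    and comult_mem: "\<And>a. a \<in> B \<Longrightarrow> Poly_Mapping.keys (delta a) \<subseteq> B \<times> B"
    and mult_assoc: "\<And>a b c. a \<in> B \<Longrightarrow> b \<in> B \<Longrightarrow> c \<in> B \<Longrightarrow>
      mult_ext mu (mu a b) (frag_of c) = mult_ext mu (frag_of a) (mu b c)"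
    and unit: "\<And>a. a \<in> B \<Longrightarrow> mu e a = frag_of a" "\<And>a. a \<in> B \<Longrightarrow> mu a e = frag_of a"
    and coassoc: "\<And>a. a \<in> B \<Longrightarrow>
      frag_extend (\<lambda>(b, c). frag_extend (\<lambda>(b1, b2). frag_of (b1, b2, c)) (delta b)) (delta a)
      = frag_extend (\<lambda>(b, c). frag_extend (\<lambda>(c1, c2). frag_of (b, c1, c2)) (delta c)) (delta a)"
    and counit: "\<And>a. a \<in> B \<Longrightarrow> frag_extend (\<lambda>(b, c). frag_cmul (eps b) (frag_of c)) (delta a) = frag_of a"
      "\<And>a. a \<in> B \<Longrightarrow> frag_extend (\<lambda>(b, c). frag_cmul (eps c) (frag_of b)) (delta a) = frag_of a"
    and comult_mult: "\<And>a b. a \<in> B \<Longrightarrow> b \<in> B \<Longrightarrow>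
      frag_extend delta (mu a b) = tensor_mult mu (delta a) (delta b)"
    and comult_unit: "delta e = frag_of (e, e)"
    and counit_mult: "\<And>a b. a \<in> B \<Longrightarrow> b \<in> B \<Longrightarrow> counit_ext eps (mu a b) = eps a * eps b"
    and counit_unit: "eps e = 1"
    and deg_mult: "\<And>a b c. a \<in> B \<Longrightarrow> b \<in> B \<Longrightarrow> c \<in> Poly_Mapping.keys (mu a b) \<Longrightarrow> deg c = deg a + deg b"
    and deg_comult: "\<And>a b c. a \<in> B \<Longrightarrow> (b, c) \<in> Poly_Mapping.keys (delta a) \<Longrightarrow> deg b + deg c = deg a"
    and deg_counit: "\<And>a. a \<in> B \<Longrightarrow> deg a \<noteq> 0 \<Longrightarrow> eps a = 0"
    and connected: "{b\<in>B. deg b = 0} = {e}"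
begin

abbreviation conv (infixl "\<star>" 70) where "f \<star> g \<equiv> convolution mu delta f g"

abbreviation conv_unit :: "'a \<Rightarrow> 'a \<Rightarrow>\<^sub>0 int" where
  "conv_unit a \<equiv> frag_cmul (eps a) (frag_of e)"

abbreviation on_basis :: "('a \<Rightarrow> 'a \<Rightarrow>\<^sub>0 int) \<Rightarrow> bool" where
  "on_basis f \<equiv> \<forall>a\<in>B. Poly_Mapping.keys (f a) \<subseteq> B"

lemma deg_unit: "deg e = 0"
  using connected by blast

lemma deg_eq_0: "b \<in> B \<Longrightarrow> deg b = 0 \<Longrightarrow> b = e"
  using connected by blast

lemma mult_ext_mem:
  assumes "Poly_Mapping.keys x \<subseteq> B" "Poly_Mapping.keys y \<subseteq> B" shows "Poly_Mapping.keys (mult_ext mu x y) \<subseteq> B"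
  unfolding mult_ext_def
proof (rule keys_frag_extend_subset, rule keys_frag_extend_subset)
  fix i j assume "i \<in> Poly_Mapping.keys x" "j \<in> Poly_Mapping.keys y"
  then show "Poly_Mapping.keys (mu i j) \<subseteq> B" using assms mult_mem by blast
qed

lemma mult_ext_unit:
  assumes "Poly_Mapping.keys x \<subseteq> B"
  shows "mult_ext mu x (frag_of e) = x" "mult_ext mu (frag_of e) x = x"
  using assms by (induction x rule: frag_induction)
    (simp_all add: unit mult_ext_diff_left mult_ext_diff_right)

lemma mult_ext_assoc:
  assumes "Poly_Mapping.keys x \<subseteq> B" "Poly_Mapping.keys y \<subseteq> B" "Poly_Mapping.keys z \<subseteq> B"
  shows "mult_ext mu (mult_ext mu x y) z = mult_ext mu x (mult_ext mu y z)"
  using assms(1)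
proof (induction x rule: frag_induction)
  case (one a)
  show ?case using assms(2)
  proof (induction y rule: frag_induction)
    case (one b)
    show ?case using assms(3)
      by (induction z rule: frag_induction)
        (use \<open>a \<in> B\<close> \<open>b \<in> B\<close> mult_assoc in \<open>simp_all add: mult_ext_diff_right\<close>)
  qed (simp_all add: mult_ext_diff_left mult_ext_diff_right)
qed (simp_all add: mult_ext_diff_left)

text \<open>Both sides extend a trilinear expression over a twofold iterated coproduct.
  Coassociativity identifies the iterated coproducts, associativity the trilinear
  expressions.\<close>

lemma convolution_assoc:
  assumes f: "on_basis f" and g: "on_basis g" and h: "on_basis h" and a: "a \<in> B"
  shows "((f \<star> g) \<star> h) a = (f \<star> (g \<star> h)) a"
proof -
  let ?F = "\<lambda>(x, y, z). mult_ext mu (mult_ext mu (f x) (g y)) (h z)"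
  let ?G = "\<lambda>(x, y, z). mult_ext mu (f x) (mult_ext mu (g y) (h z))"
  have "((f \<star> g) \<star> h) a = frag_extend ?F
     (frag_extend (\<lambda>(b, c). frag_extend (\<lambda>(b1, b2). frag_of (b1, b2, c)) (delta b)) (delta a))"
    by (simp add: convolution_def frag_extend_frag_extend mult_ext_frag_extend_left case_prod_unfold)
  also have "\<dots> = frag_extend ?F
     (frag_extend (\<lambda>(b, c). frag_extend (\<lambda>(c1, c2). frag_of (b, c1, c2)) (delta c)) (delta a))"
    by (simp only: coassoc[OF a])
  \<comment> \<open>Associativity is available only for elements supported on \<open>B\<close>, so
    the iterated coproduct first has to be located in the triple product of
    \<open>B\<close>.\<close>
  also have "\<dots> = frag_extend ?G
     (frag_extend (\<lambda>(b, c). frag_extend (\<lambda>(c1, c2). frag_of (b, c1, c2)) (delta c)) (delta a))"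
  proof (rule frag_extend_eq)
    fix i assume "i \<in> Poly_Mapping.keys (frag_extend (\<lambda>(b, c). frag_extend (\<lambda>(c1, c2). frag_of (b, c1, c2)) (delta c)) (delta a))"
    moreover have "Poly_Mapping.keys (frag_extend (\<lambda>(b, c). frag_extend (\<lambda>(c1, c2). frag_of (b, c1, c2)) (delta c)) (delta a))
        \<subseteq> B \<times> B \<times> B"
    proof (rule keys_frag_extend_pair_subset)
      fix b c
      assume bc: "(b, c) \<in> Poly_Mapping.keys (delta a)"
      have "b \<in> B" "c \<in> B" using bc comult_mem[OF a] by auto
      then show "Poly_Mapping.keys (frag_extend (\<lambda>(c1, c2). frag_of (b, c1, c2)) (delta c)) \<subseteq> B \<times> B \<times> B"
        using comult_mem[of c] by (intro keys_frag_extend_pair_subset) auto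
    qed
    ultimately show "?F i = ?G i"
      using f g h mult_ext_assoc by auto
  qed
  also have "\<dots> = (f \<star> (g \<star> h)) a"
    by (simp add: convolution_def frag_extend_frag_extend mult_ext_frag_extend_right case_prod_unfold)
  finally show ?thesis .
qed

text \<open>Pulling the linear extension of \<open>f\<close> out of the sum leaves exactly the
  counit axiom.\<close>

lemma convolution_unit:
  assumes f: "on_basis f" and a: "a \<in> B"
  shows "(conv_unit \<star> f) a = f a" "(f \<star> conv_unit) a = f a"
proof -
  have "(conv_unit \<star> f) a = frag_extend f (frag_extend (\<lambda>(b, c). frag_cmul (eps b) (frag_of c)) (delta a))"
    unfolding convolution_def frag_extend_frag_extend
    using f comult_mem[OF a]
    by (intro frag_extend_eq) (auto simp: mult_ext_cmul mult_ext_unit frag_extend_cmul)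
  then show "(conv_unit \<star> f) a = f a" by (simp add: counit a)
  have "(f \<star> conv_unit) a = frag_extend f (frag_extend (\<lambda>(b, c). frag_cmul (eps c) (frag_of b)) (delta a))"
    unfolding convolution_def frag_extend_frag_extend
    using f comult_mem[OF a]
    by (intro frag_extend_eq) (auto simp: mult_ext_cmul mult_ext_unit frag_extend_cmul)
  then show "(f \<star> conv_unit) a = f a" by (simp add: counit a)
qed

lemma convolution_cong:
  assumes "\<And>a. a \<in> B \<Longrightarrow> f a = f' a" "\<And>a. a \<in> B \<Longrightarrow> g a = g' a" "a \<in> B"
  shows "(f \<star> g) a = (f' \<star> g') a"
  unfolding convolution_def using comult_mem[OF assms(3)] assms(1,2)
  by (intro frag_extend_pair_cong) (auto simp: subset_iff)

text \<open>Takeuchi's recursion: the value at a basis element is forced by the values at smaller degrees.\<close>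

lemma convolution_left_inverse:
  assumes f: "on_basis f" and fe: "f e = frag_of e"
  obtains g where "on_basis g" "g e = frag_of e" "\<And>a. a \<in> B \<Longrightarrow> (g \<star> f) a = conv_unit a"
proof -
  \<comment> \<open>The guard makes the recursion well founded. It removes the terms with
    \<open>deg c = 0\<close>, that is \<open>c = e\<close>, whose total contribution is the unknown
    \<open>g a\<close> itself. At \<open>a = e\<close> nothing would be left, so this value is
    prescribed.\<close>
  define H :: "('a \<Rightarrow> 'a \<Rightarrow>\<^sub>0 int) \<Rightarrow> 'a \<Rightarrow> 'a \<Rightarrow>\<^sub>0 int" where
    "H = (\<lambda>g a. if a = e then frag_of e else
      - frag_extend (\<lambda>(b, c). if deg b < deg a then mult_ext mu (g b) (f c) else 0) (delta a))"
  define g where "g = wfrec (measure deg) H"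
  have "adm_wf (measure deg) H"
    unfolding adm_wf_def H_def
    by (auto intro!: frag_extend_pair_cong)
  then have g_eq: "g a = H g a" for a
    using wfrec_fixpoint[of "measure deg" H] unfolding g_def by (metis wf_measure)
  have ge: "g e = frag_of e" by (subst g_eq) (simp add: H_def)
  have gB: "Poly_Mapping.keys (g a) \<subseteq> B" if "a \<in> B" for a
    using that
  proof (induction "deg a" arbitrary: a rule: less_induct)
    case less
    show ?case
    proof (cases "a = e")
      case True then show ?thesis using ge unit_mem by simp
    next
      case False
      have "Poly_Mapping.keys (frag_extend (\<lambda>(b, c). if deg b < deg a then mult_ext mu (g b) (f c) else 0) (delta a)) \<subseteq> B"
      proof (rule keys_frag_extend_pair_subset)
        fix b c
        assume bc: "(b, c) \<in> Poly_Mapping.keys (delta a)"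
        have "b \<in> B" "c \<in> B" using bc comult_mem[OF \<open>a \<in> B\<close>] by auto
        then show "Poly_Mapping.keys (if deg b < deg a then mult_ext mu (g b) (f c) else 0) \<subseteq> B"
          using less(1)[of b] mult_ext_mem f by simp
      qed
      then show ?thesis using False by (subst g_eq) (simp add: H_def)
    qed
  qed
  have "(g \<star> f) a = conv_unit a" if a: "a \<in> B" for a
  proof (cases "a = e")
    case True
    then show ?thesis
      using unit_mem by (simp add: convolution_def comult_unit ge fe unit counit_unit)
  next
    case False
    then have da: "deg a \<noteq> 0" using a deg_eq_0 by blast
    let ?L = "\<lambda>b c. if deg b < deg a then mult_ext mu (g b) (f c) else 0"
    \<comment> \<open>At most one of \<open>?L\<close> and \<open>?R\<close> is nonzero: if
      \<open>deg c = 0\<close>, then \<open>c = e\<close> and the guard fails; otherwise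
      \<open>eps c = 0\<close>. The counit thus isolates the terms that the guard removed, and the
      counit axiom sums them to \<open>g a\<close>.\<close>
    let ?R = "\<lambda>b c. frag_cmul (eps c) (g b)"
    have "(g \<star> f) a = frag_extend (\<lambda>(b, c). ?L b c + ?R b c) (delta a)"
      unfolding convolution_def
    proof (rule frag_extend_pair_cong)
      fix b c assume bc: "(b, c) \<in> Poly_Mapping.keys (delta a)"
      have mem: "b \<in> B" "c \<in> B" using bc comult_mem[OF a] by auto
      have d: "deg b + deg c = deg a" using deg_comult[OF a bc] .
      show "mult_ext mu (g b) (f c) = ?L b c + ?R b c"
      proof (cases "deg c = 0")
        case True
        then have "c = e" using mem deg_eq_0 by blast
        then show ?thesis
          using d True gB mem by (simp add: fe counit_unit mult_ext_unit)
      next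
        case False
        then show ?thesis using d mem deg_counit by simp
      qed
    qed
    also have "\<dots> = frag_extend (\<lambda>(b, c). ?L b c) (delta a) + frag_extend (\<lambda>(b, c). ?R b c) (delta a)"
      using frag_extend_fun_add[of "\<lambda>(b, c). ?L b c" "\<lambda>(b, c). ?R b c" "delta a"]
      by (simp add: case_prod_unfold)
    also have "frag_extend (\<lambda>(b, c). ?L b c) (delta a) = - g a"
      using False by (subst g_eq) (simp add: H_def)
    also have "frag_extend (\<lambda>(b, c). ?R b c) (delta a) =
        frag_extend g (frag_extend (\<lambda>(b, c). frag_cmul (eps c) (frag_of b)) (delta a))"
      by (simp add: frag_extend_frag_extend case_prod_unfold frag_extend_cmul)
    also have "\<dots> = g a" by (simp add: counit a)
    finally show ?thesis using deg_counit[OF a da] by simp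
  qed
  then show thesis using that ge gB by blast
qed

text \<open>A left inverse of the identity has itself a left inverse, which must be the identity.\<close>

lemma antipode_exists:
  "\<exists>S. on_basis S \<and> (\<forall>a\<in>B. (S \<star> frag_of) a = conv_unit a \<and> (frag_of \<star> S) a = conv_unit a)"
proof -
  have id: "on_basis frag_of" by simp
  have un: "on_basis conv_unit" using unit_mem keys_cmul by fastforce
  obtain S where S: "on_basis S" "S e = frag_of e" "\<And>a. a \<in> B \<Longrightarrow> (S \<star> frag_of) a = conv_unit a"
    using convolution_left_inverse[OF id] by auto
  obtain T where T: "on_basis T" "T e = frag_of e" "\<And>a. a \<in> B \<Longrightarrow> (T \<star> S) a = conv_unit a"
    using convolution_left_inverse[OF S(1,2)] by auto
  have T_eq: "T a = frag_of a" if a: "a \<in> B" for a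
  proof -
    have "T a = (T \<star> conv_unit) a" using convolution_unit(2)[OF T(1) a] by simp
    also have "\<dots> = (T \<star> (S \<star> frag_of)) a" using a S(3) by (intro convolution_cong) auto
    also have "\<dots> = ((T \<star> S) \<star> frag_of) a" using convolution_assoc[OF T(1) S(1) id a] by simp
    also have "\<dots> = (conv_unit \<star> frag_of) a" using a T(3) by (intro convolution_cong) auto
    also have "\<dots> = frag_of a" using convolution_unit(1)[OF id a] by simp
    finally show ?thesis .
  qed
  have "(frag_of \<star> S) a = conv_unit a" if a: "a \<in> B" for a
    using convolution_cong[of T frag_of S S a] T_eq a T(3)[OF a] by simp
  with S show ?thesis by blast
qed

lemma hopf_algebra: "hopf_algebra B e mu delta eps"
  unfolding hopf_algebra_def
proof (intro conjI)
  show "\<exists>S. (\<forall>a\<in>B. Poly_Mapping.keys (S a) \<subseteq> B) \<and>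
      (\<forall>a\<in>B. frag_extend (\<lambda>(b, c). mult_ext mu (S b) (frag_of c)) (delta a) = conv_unit a \<and>
        frag_extend (\<lambda>(b, c). mult_ext mu (frag_of b) (S c)) (delta a) = conv_unit a)"
    using antipode_exists unfolding convolution_def .
qed (intro ballI conjI unit_mem mult_mem comult_mem mult_assoc unit coassoc counit comult_mult
    comult_unit counit_mult counit_unit; assumption)+

lemma graded_connected: "graded_connected B e mu delta eps deg"
  unfolding graded_connected_def
proof (intro conjI ballI impI)
  fix a bc assume "a \<in> B" "bc \<in> Poly_Mapping.keys (delta a)"
  then show "case bc of (b, c) \<Rightarrow> deg b + deg c = deg a"
    using deg_comult by (cases bc) simp
qed (rule deg_unit connected | erule (2) deg_mult | erule (1) deg_counit)+

end

subsection \<open>Relabelling and restriction of set compositions\<close>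

declare One_nat_def [simp del]

section \<open>Uniqueness and existence of order isomorphisms\<close>

text \<open>Since \<open>f\<close> preserves and reflects the order, the number of elements of
  \<open>S\<close> below \<open>x\<close> is the position of \<open>f x\<close> in the sorted image.
  This uniqueness is what later replaces unfolding \<open>ord_iso\<close>.\<close>

lemma ord_iso_image_eq:
  assumes fin: "finite S" and f: "strict_mono_on S f" and x: "x \<in> S"
  shows "ord_iso S (f ` S) x = f x"
proof -
  let ?xs = "sorted_list_of_set (f ` S)"
  have inj: "inj_on f S" using f by (rule strict_mono_on_imp_inj_on)
  have "f x \<in> set ?xs" using fin x by simp
  then obtain i where i: "i < length ?xs" "?xs ! i = f x" by (metis in_set_conv_nth)
  have sd: "sorted_wrt (<) ?xs" by (rule strict_sorted_list_of_set)
  have lt: "?xs ! j < ?xs ! k \<longleftrightarrow> j < k" if "j < length ?xs" "k < length ?xs" for j k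
    using sorted_wrt_nth_less[OF sd, of j k] sorted_wrt_nth_less[OF sd, of k j] that
    by (metis linorder_neqE_nat order_less_asym order_less_irrefl)
  have "f ` {y\<in>S. y < x} = {v \<in> f ` S. v < f x}"
    using f x by (auto simp: strict_mono_on_less)
  also have "\<dots> = {v \<in> set ?xs. v < f x}" using fin by simp
  also have "\<dots> = (\<lambda>j. ?xs ! j) ` {..<i}"
  proof (intro equalityI subsetI)
    fix v assume "v \<in> {v \<in> set ?xs. v < f x}"
    then obtain j where "j < length ?xs" "v = ?xs ! j" "v < f x"
      by (metis (lifting) in_set_conv_nth mem_Collect_eq)
    then show "v \<in> (\<lambda>j. ?xs ! j) ` {..<i}" using lt[of j i] i by simp
  next
    fix v assume "v \<in> (\<lambda>j. ?xs ! j) ` {..<i}"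
    then obtain j where "j < i" "v = ?xs ! j" by blast
    then show "v \<in> {v \<in> set ?xs. v < f x}" using lt[of j i] i nth_mem[of j ?xs] by simp
  qed
  finally have "card (f ` {y\<in>S. y < x}) = card ((\<lambda>j. ?xs ! j) ` {..<i})" by simp
  also have "card (f ` {y\<in>S. y < x}) = card {y\<in>S. y < x}"
    by (rule card_image, rule inj_on_subset[OF inj]) blast
  also have "card ((\<lambda>j. ?xs ! j) ` {..<i}) = card {..<i}"
    using i by (intro card_image inj_on_nth) (auto simp: distinct_sorted_list_of_set)
  finally have "card {y\<in>S. y < x} = i" by simp
  then show ?thesis using i by (simp add: ord_iso_def)
qed

lemma ord_iso_eq:
  assumes "finite S" "strict_mono_on S f" "f ` S = T" "x \<in> S"
  shows "ord_iso S T x = f x"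
  using ord_iso_image_eq[OF assms(1,2,4)] assms(3) by simp

lemma ord_iso_strict_mono_image:
  assumes fin: "finite S" "finite T" and card: "card S = card T"
  shows "strict_mono_on S (ord_iso S T)" "ord_iso S T ` S = T"
proof -
  let ?xs = "sorted_list_of_set T"
  have len: "length ?xs = card S" using card fin by simp
  have less: "card {z\<in>S. z < x} < card {z\<in>S. z < y}" if "x \<in> S" "y \<in> S" "x < y" for x y
    using that fin by (intro psubset_card_mono) auto
  have bound: "card {z\<in>S. z < x} < card S" if "x \<in> S" for x
    using that fin by (intro psubset_card_mono) auto
  show sm: "strict_mono_on S (ord_iso S T)"
  proof (rule strict_mono_onI)
    fix x y assume "x \<in> S" "y \<in> S" "x < y"
    then show "ord_iso S T x < ord_iso S T y"
      unfolding ord_iso_def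
      using less bound len strict_sorted_list_of_set[of T] by (intro sorted_wrt_nth_less[of "(<)" ?xs]) auto
  qed
  have "ord_iso S T ` S \<subseteq> T"
  proof clarify
    fix x assume "x \<in> S"
    then have "?xs ! card {z\<in>S. z < x} \<in> set ?xs" using bound len by (intro nth_mem) auto
    then show "ord_iso S T x \<in> T" using fin by (simp add: ord_iso_def)
  qed
  moreover have "card (ord_iso S T ` S) = card T"
    using card card_image strict_mono_on_imp_inj_on[OF sm] by metis
  ultimately show "ord_iso S T ` S = T" using fin by (simp add: card_subset_eq)
qed

section \<open>Relabelling, traces and standardized restriction\<close>

abbreviation relabel :: "(nat \<Rightarrow> nat) \<Rightarrow> scomp \<Rightarrow> scomp" where
  "relabel f \<equiv> map ((`) f)"

text \<open>Restriction before standardization. Traces on nested sets compose without any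
  relabelling, so splitting \<open>restr\<close> in this way confines standardization to a single
  outer map.\<close>

definition trace :: "scomp \<Rightarrow> nat set \<Rightarrow> scomp" where
  "trace P A = filter (\<lambda>B. B \<noteq> {}) (map (\<lambda>B. B \<inter> A) P)"

lemma restr_trace: "restr P A = is_map A {1..card A} (trace P A)"
  by (simp add: restr_def trace_def)

lemma Union_relabel: "\<Union>(set (relabel f P)) = f ` \<Union>(set P)"
  by auto

lemma relabel_relabel: "relabel f (relabel g P) = relabel (\<lambda>x. f (g x)) P"
  by (auto simp: image_image)

lemma relabel_cong:
  assumes "\<And>x. x \<in> \<Union>(set P) \<Longrightarrow> f x = g x"
  shows "relabel f P = relabel g P"
  using assms by (auto intro!: image_cong)

lemma relabel_id:
  assumes "\<And>x. x \<in> \<Union>(set P) \<Longrightarrow> f x = x"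
  shows "relabel f P = P"
  by (rule map_idI) (use assms in \<open>force simp: image_iff\<close>)

lemma is_map_relabel:
  assumes "finite S" "strict_mono_on S f" "f ` S = T" "\<Union>(set P) \<subseteq> S"
  shows "is_map S T P = relabel f P"
  unfolding is_map_def using assms by (intro relabel_cong) (auto simp: ord_iso_eq)

lemma is_map_ord_iso: "is_map S T P = relabel (ord_iso S T) P"
  by (simp add: is_map_def)

lemma Union_trace: "\<Union>(set (trace P A)) = \<Union>(set P) \<inter> A"
  by (auto simp: trace_def)

lemma trace_append: "trace (P @ Q) A = trace P A @ trace Q A"
  by (simp add: trace_def)

lemma trace_trace: "B \<subseteq> A \<Longrightarrow> trace (trace P A) B = trace P B"
proof -
  assume "B \<subseteq> A"
  then have *: "X \<inter> A \<inter> B = X \<inter> B" for X by blast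
  show ?thesis
    by (induction P) (use \<open>B \<subseteq> A\<close> in \<open>auto simp: trace_def *\<close>)
qed

lemma trace_cong: "\<Union>(set P) \<inter> A = \<Union>(set P) \<inter> B \<Longrightarrow> trace P A = trace P B"
  unfolding trace_def by (rule arg_cong[where f = "filter _"]) auto

lemma trace_relabel:
  assumes "inj_on f S" "\<Union>(set P) \<subseteq> S" "A \<subseteq> S"
  shows "trace (relabel f P) (f ` A) = relabel f (trace P A)"
  using assms(2)
proof (induction P)
  case (Cons X P)
  then have "f ` X \<inter> f ` A = f ` (X \<inter> A)"
    using inj_on_image_Int[OF assms(1), of X A] assms(3) by simp
  with Cons show ?case by (simp add: trace_def)
qed (simp add: trace_def)

text \<open>The standardizing map may be chosen freely. It is applied with the identity, with
  truncated subtraction on an interval, with a piecewise map and with composites.\<close>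

lemma restr_relabel_trace:
  assumes "finite A" "strict_mono_on A f" "f ` A = {1..card A}"
  shows "restr P A = relabel f (trace P A)"
  unfolding restr_trace using assms by (intro is_map_relabel) (auto simp: Union_trace)

abbreviation stdz :: "nat set \<Rightarrow> nat \<Rightarrow> nat" where
  "stdz A \<equiv> ord_iso A {1..card A}"

lemma stdz_strict_mono: "finite A \<Longrightarrow> strict_mono_on A (stdz A)"
  and stdz_image: "finite A \<Longrightarrow> stdz A ` A = {1..card A}"
  by (simp_all add: ord_iso_strict_mono_image)

lemma stdz_inj: "finite A \<Longrightarrow> inj_on (stdz A) A"
  using stdz_strict_mono strict_mono_on_imp_inj_on by blast

lemma restr_stdz: "restr P A = relabel (stdz A) (trace P A)"
  by (simp add: restr_trace is_map_ord_iso)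

lemma strict_mono_on_comp:
  assumes "strict_mono_on S f" "strict_mono_on (f ` S) g"
  shows "strict_mono_on S (\<lambda>x. g (f x))"
  using assms unfolding strict_mono_on_def by auto

text \<open>Standardizing the image of \<open>A\<close> after applying \<open>f\<close> is again
  strictly monotone on \<open>A\<close> with image an initial segment, hence a legitimate
  standardization of \<open>A\<close>.\<close>

lemma restr_relabel:
  assumes fin: "finite S" and f: "strict_mono_on S f" and P: "\<Union>(set P) \<subseteq> S" and A: "A \<subseteq> S"
  shows "restr (relabel f P) (f ` A) = restr P A"
proof -
  have finA: "finite A" using A fin finite_subset by blast
  have inj: "inj_on f S" using f by (rule strict_mono_on_imp_inj_on)
  then have cardA: "card (f ` A) = card A" using A by (meson card_image inj_on_subset)
  have fA: "strict_mono_on A f" using f A by (rule monotone_on_subset)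
  let ?h = "stdz (f ` A)"
  have "restr (relabel f P) (f ` A) = relabel (\<lambda>x. ?h (f x)) (trace P A)"
    by (simp only: restr_stdz trace_relabel[OF inj P A] relabel_relabel)
  also have "\<dots> = restr P A"
    using finA stdz_strict_mono[of "f ` A"] stdz_image[of "f ` A"]
    by (intro restr_relabel_trace[symmetric] strict_mono_on_comp[OF fA])
      (auto simp: cardA simp flip: image_image)
  finally show ?thesis .
qed

text \<open>After restriction to \<open>A\<close>, the subset \<open>B\<close> occupies the
  positions \<open>stdz A\<close> assigns to it. The outer restriction absorbs this relabelling
  because it is strictly monotone.\<close>

lemma restr_restr:
  assumes "finite A" "B \<subseteq> A"
  shows "restr (restr P A) (stdz A ` B) = restr P B"
proof -
  have "restr (restr P A) (stdz A ` B) = restr (trace P A) B"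
    unfolding restr_stdz[of P A] using assms
    by (intro restr_relabel[of A] stdz_strict_mono) (auto simp: Union_trace)
  also have "\<dots> = restr P B" using assms by (simp add: restr_stdz trace_trace)
  finally show ?thesis .
qed

section \<open>Set compositions under concatenation, relabelling and restriction\<close>

text \<open>Disjointness is symmetric, so pairs \<open>i < j\<close> suffice. In the form
  \<open>sorted_wrt\<close> it passes through append, map and filter.\<close>

lemma is_setcomp_iff:
  "is_setcomp S P \<longleftrightarrow> {} \<notin> set P \<and> sorted_wrt disjnt P \<and> \<Union>(set P) = S"
proof -
  have "(\<forall>i<length P. \<forall>j<length P. i \<noteq> j \<longrightarrow> P ! i \<inter> P ! j = {}) \<longleftrightarrow> sorted_wrt disjnt P"
    (is "?l = ?r")
  proof
    show "?l \<Longrightarrow> ?r" by (simp add: sorted_wrt_iff_nth_less disjnt_def)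
    show "?l" if ?r
    proof (intro allI impI)
      fix i j assume "i < length P" "j < length P" "i \<noteq> j"
      then show "P ! i \<inter> P ! j = {}"
        using sorted_wrt_nth_less[OF that, of i j] sorted_wrt_nth_less[OF that, of j i]
        by (cases "i < j") (auto simp: disjnt_def)
    qed
  qed
  then show ?thesis unfolding is_setcomp_def by blast
qed

lemma is_setcomp_Nil [simp]: "is_setcomp S [] \<longleftrightarrow> S = {}"
  by (auto simp: is_setcomp_iff)

lemma is_setcomp_empty [simp]: "is_setcomp {} P \<longleftrightarrow> P = []"
  by (cases P) (auto simp: is_setcomp_iff)

lemma is_setcomp_append:
  "is_setcomp S (P @ Q) \<longleftrightarrow>
    (\<exists>A B. is_setcomp A P \<and> is_setcomp B Q \<and> A \<inter> B = {} \<and> A \<union> B = S)"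
  (is "_ \<longleftrightarrow> ?r")
proof
  assume "is_setcomp S (P @ Q)"
  then have "is_setcomp (\<Union>(set P)) P" "is_setcomp (\<Union>(set Q)) Q"
    "\<Union>(set P) \<inter> \<Union>(set Q) = {}" "\<Union>(set P) \<union> \<Union>(set Q) = S"
    by (auto simp: is_setcomp_iff sorted_wrt_append disjnt_def)
  then show ?r by blast
next
  assume ?r
  then obtain A B where *: "is_setcomp A P" "is_setcomp B Q" "A \<inter> B = {}" "A \<union> B = S" by blast
  have "disjnt X Y" if "X \<in> set P" "Y \<in> set Q" for X Y
    using * that unfolding is_setcomp_iff disjnt_def by blast
  then show "is_setcomp S (P @ Q)"
    using * by (simp add: is_setcomp_iff sorted_wrt_append)
qed

lemma is_setcomp_Union: "is_setcomp S P \<Longrightarrow> \<Union>(set P) = S"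
  by (simp add: is_setcomp_iff)

lemma is_setcomp_relabel:
  assumes "is_setcomp S P" "inj_on f S"
  shows "is_setcomp (f ` S) (relabel f P)"
proof -
  have "sorted_wrt (\<lambda>X Y. disjnt (f ` X) (f ` Y)) P"
  proof (rule sorted_wrt_mono_rel)
    show "sorted_wrt disjnt P" using assms by (simp add: is_setcomp_iff)
    fix X Y assume "X \<in> set P" "Y \<in> set P" "disjnt X Y"
    moreover from this have "X \<subseteq> S" "Y \<subseteq> S" using assms by (auto simp: is_setcomp_iff)
    ultimately show "disjnt (f ` X) (f ` Y)"
      using inj_on_image_Int[OF assms(2), of X Y] by (auto simp: disjnt_def)
  qed
  moreover have "\<Union>(set (relabel f P)) = f ` S"
    using assms(1) by (simp only: Union_relabel is_setcomp_Union)
  ultimately show ?thesis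
    using assms(1) by (simp add: is_setcomp_iff sorted_wrt_map image_iff)
qed

lemma is_setcomp_trace:
  assumes "is_setcomp S P" "A \<subseteq> S"
  shows "is_setcomp A (trace P A)"
proof -
  have "sorted_wrt (\<lambda>X Y. disjnt (X \<inter> A) (Y \<inter> A)) P"
    by (rule sorted_wrt_mono_rel[of _ disjnt]) (use assms in \<open>auto simp: is_setcomp_iff disjnt_def\<close>)
  then have "sorted_wrt disjnt (trace P A)"
    by (simp add: trace_def sorted_wrt_map sorted_wrt_filter)
  moreover have "\<Union>(set (trace P A)) = A"
    using assms by (auto simp: Union_trace is_setcomp_Union)
  moreover have "{} \<notin> set (trace P A)" by (simp add: trace_def)
  ultimately show ?thesis by (simp add: is_setcomp_iff)
qed

lemma trace_full: "is_setcomp S P \<Longrightarrow> trace P S = P"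
proof -
  assume "is_setcomp S P"
  then have "{} \<notin> set P" "\<Union>(set P) \<subseteq> S" by (auto simp: is_setcomp_iff)
  then show ?thesis by (induction P) (auto simp: trace_def)
qed

lemma trace_empty [simp]: "trace P {} = []"
  by (simp add: trace_def)

lemma restr_empty [simp]: "restr P {} = []"
  by (simp add: restr_stdz)

lemma is_setcomp_restr:
  assumes "is_setcomp S P" "A \<subseteq> S" "finite A"
  shows "is_setcomp {1..card A} (restr P A)"
  using is_setcomp_relabel[OF is_setcomp_trace[OF assms(1,2)] stdz_inj[OF assms(3)]]
  by (simp add: restr_stdz stdz_image[OF assms(3)])

lemma strict_mono_on_id: "strict_mono_on S (\<lambda>x::nat. x)"
  by (auto simp: strict_mono_on_def)

lemma restr_initial:
  "restr P {1..n} = trace P {1..n}"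
  using restr_relabel_trace[of "{1..n}" "\<lambda>x. x" P] by (simp add: strict_mono_on_id relabel_id)

lemma restr_full: "is_setcomp {1..n} P \<Longrightarrow> restr P {1..n} = P"
  using restr_initial[of P n] trace_full by simp

lemma is_setcomp_cdeg: "is_setcomp {1..n} P \<Longrightarrow> cdeg P = n"
  by (simp add: cdeg_def is_setcomp_Union)

lemma CompsD: "P \<in> Comps \<Longrightarrow> is_setcomp {1..cdeg P} P"
  unfolding Comps_def Comp_def using is_setcomp_cdeg by auto

lemma CompsI: "is_setcomp {1..n} P \<Longrightarrow> P \<in> Comps"
  unfolding Comps_def Comp_def by auto

lemma Comp_iff: "P \<in> Comp n \<longleftrightarrow> P \<in> Comps \<and> cdeg P = n"
  using CompsD CompsI is_setcomp_cdeg by (auto simp: Comp_def)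

lemma restr_Comps:
  assumes "P \<in> Comps" "A \<subseteq> {1..cdeg P}"
  shows "restr P A \<in> Comps" "cdeg (restr P A) = card A"
proof -
  have "finite A" using assms(2) by (rule finite_subset) simp
  from is_setcomp_restr[OF CompsD[OF assms(1)] assms(2) this]
  show "restr P A \<in> Comps" "cdeg (restr P A) = card A"
    by (rule CompsI is_setcomp_cdeg)+
qed

lemma Nil_Comps [simp]: "[] \<in> Comps" "cdeg [] = 0"
  using CompsI[of 0 "[]"] by (simp_all add: cdeg_def)

lemma cdeg_0: "P \<in> Comps \<Longrightarrow> cdeg P = 0 \<longleftrightarrow> P = []"
  using CompsD[of P] by auto

lemma restr_eq_Nil:
  assumes "P \<in> Comps" "A \<subseteq> {1..cdeg P}"
  shows "restr P A = [] \<longleftrightarrow> A = {}"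
  using restr_Comps[OF assms] cdeg_0[of "restr P A"] assms(2) finite_subset[OF assms(2)] by auto

subsection \<open>The coproducts\<close>

text \<open>\<open>D S\<close> lists the admissible first halves \<open>A\<close> of splittings of
  \<open>S\<close> into \<open>A\<close> and \<open>S - A\<close>. The condition
  \<open>image_iff\<close> says that admissibility depends only on the order, so standardization
  does not affect it. In \<open>coassoc\<close>, the chain from \<open>B\<close> over
  \<open>A\<close> to \<open>S\<close> stands for the three parts \<open>B\<close>,
  \<open>A - B\<close>, \<open>S - A\<close>; the condition says that both ways of producing them by
  two splittings are admissible together.\<close>

locale split_family =
  fixes D :: "nat set \<Rightarrow> nat set set"
  assumes subset: "A \<in> D S \<Longrightarrow> A \<subseteq> S"
    and empty: "{} \<in> D S" and full: "S \<in> D S"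
    and image_iff: "\<lbrakk>finite S; strict_mono_on S f; A \<subseteq> S\<rbrakk> \<Longrightarrow> f ` A \<in> D (f ` S) \<longleftrightarrow> A \<in> D S"
    and coassoc: "\<lbrakk>B \<subseteq> A; A \<subseteq> S\<rbrakk> \<Longrightarrow>
      A \<in> D S \<and> B \<in> D A \<longleftrightarrow> B \<in> D S \<and> A - B \<in> D (S - B)"
begin

definition split_delta :: "scomp \<Rightarrow> (scomp \<times> scomp) \<Rightarrow>\<^sub>0 int" where
  "split_delta P = (\<Sum>A\<in>D {1..cdeg P}. frag_of (restr P A, restr P ({1..cdeg P} - A)))"

lemma finite_D: "finite S \<Longrightarrow> finite (D S)"
  using subset by (intro finite_subset[of "D S" "Pow S"]) auto

lemma sum_stdz:
  assumes "finite A"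
  shows "(\<Sum>B\<in>D {1..card A}. F B) = (\<Sum>B\<in>D A. F (stdz A ` B))"
proof -
  have inj: "inj_on (stdz A) A" using assms by (rule stdz_inj)
  have "D {1..card A} = (`) (stdz A) ` D A"
  proof (intro equalityI subsetI)
    fix C assume C: "C \<in> D {1..card A}"
    then have "C \<subseteq> stdz A ` A" using subset stdz_image[OF assms] by metis
    then obtain B where B: "B \<subseteq> A" "C = stdz A ` B" by (meson subset_imageE)
    then have "B \<in> D A"
      using C image_iff[OF assms stdz_strict_mono[OF assms] B(1)] stdz_image[OF assms] by simp
    then show "C \<in> (`) (stdz A) ` D A" using B by blast
  next
    fix C assume "C \<in> (`) (stdz A) ` D A"
    then obtain B where B: "B \<in> D A" "C = stdz A ` B" by blast
    then show "C \<in> D {1..card A}"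
      using image_iff[OF assms stdz_strict_mono[OF assms] subset[OF B(1)]] stdz_image[OF assms] by simp
  qed
  moreover have "inj_on ((`) (stdz A)) (D A)"
    by (rule inj_on_subset[OF inj_on_image_Pow[OF inj]]) (use subset in blast)
  ultimately show ?thesis by (simp add: sum.reindex)
qed

lemma restr_restr_compl:
  assumes "finite A" "B \<subseteq> A"
  shows "restr (restr P A) ({1..card A} - stdz A ` B) = restr P (A - B)"
proof -
  have "{1..card A} - stdz A ` B = stdz A ` (A - B)"
    using inj_on_image_set_diff[OF stdz_inj[OF assms(1)], of A B] stdz_image[OF assms(1)] assms by auto
  then show ?thesis using restr_restr[OF assms(1), of "A - B" P] by auto
qed

text \<open>Removes standardization from iterated coproducts: the second splitting is indexed by
  subsets of the original ground set as well.\<close>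

lemma split_delta_restr:
  assumes "P \<in> Comps" "A \<subseteq> {1..cdeg P}"
  shows "split_delta (restr P A) = (\<Sum>B\<in>D A. frag_of (restr P B, restr P (A - B)))"
proof -
  have fin: "finite A" using assms(2) by (rule finite_subset) simp
  show ?thesis
    unfolding split_delta_def restr_Comps(2)[OF assms] sum_stdz[OF fin]
    by (rule sum.cong) (use fin subset in \<open>auto simp: restr_restr restr_restr_compl\<close>)
qed

lemma split_delta_mem:
  assumes "P \<in> Comps" shows "Poly_Mapping.keys (split_delta P) \<subseteq> Comps \<times> Comps"
proof -
  have "(restr P A, restr P ({1..cdeg P} - A)) \<in> Comps \<times> Comps" if "A \<in> D {1..cdeg P}" for A
    using restr_Comps(1)[OF assms] subset[OF that] by auto
  then show ?thesis
    unfolding split_delta_def by (intro order.trans[OF keys_sum_frag_of]) blast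
qed

lemma split_delta_deg:
  assumes "P \<in> Comps" "(Q, R) \<in> Poly_Mapping.keys (split_delta P)"
  shows "cdeg Q + cdeg R = cdeg P"
proof -
  obtain A where A: "A \<in> D {1..cdeg P}" "Q = restr P A" "R = restr P ({1..cdeg P} - A)"
    using assms(2) keys_sum_frag_of[of "\<lambda>A. (restr P A, restr P ({1..cdeg P} - A))" "D {1..cdeg P}"]
    unfolding split_delta_def by blast
  have sub: "A \<subseteq> {1..cdeg P}" using subset A(1) .
  then have "cdeg R = cdeg P - card A"
    using A assms(1) by (simp add: restr_Comps card_Diff_subset finite_subset)
  moreover have "cdeg Q = card A" using A sub assms(1) by (simp add: restr_Comps)
  moreover have "card A \<le> cdeg P" using card_mono[OF _ sub] by simp
  ultimately show ?thesis by simp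
qed

lemma split_delta_Nil: "split_delta [] = frag_of ([], [])"
proof -
  have "D {} = {{}}" using subset empty by blast
  then show ?thesis by (simp add: split_delta_def)
qed

text \<open>A restriction is \<open>[]\<close> only on the empty set, so the counit keeps a single
  splitting, whose other half is the full restriction, that is \<open>P\<close>.\<close>

lemma split_delta_counit:
  assumes P: "P \<in> Comps"
  shows "frag_extend (\<lambda>(b, c). frag_cmul (t_eps b) (frag_of c)) (split_delta P) = frag_of P"
    and "frag_extend (\<lambda>(b, c). frag_cmul (t_eps c) (frag_of b)) (split_delta P) = frag_of P"
proof -
  let ?S = "{1..cdeg P}"
  have full_P: "restr P ?S = P" using restr_full CompsD P by blast
  have "frag_extend (\<lambda>(b, c). frag_cmul (t_eps b) (frag_of c)) (split_delta P) =
      (\<Sum>A\<in>D ?S. frag_cmul (t_eps (restr P A)) (frag_of (restr P (?S - A))))"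
    by (simp add: split_delta_def frag_extend_sum_of)
  also have "\<dots> = (\<Sum>A\<in>D ?S. if A = {} then frag_of P else 0)"
    by (intro sum.cong refl) (use subset P full_P in \<open>auto simp: t_eps_def restr_eq_Nil\<close>)
  also have "\<dots> = frag_of P"
    using empty finite_D[of ?S] by simp
  finally show "frag_extend (\<lambda>(b, c). frag_cmul (t_eps b) (frag_of c)) (split_delta P) = frag_of P" .
  have "frag_extend (\<lambda>(b, c). frag_cmul (t_eps c) (frag_of b)) (split_delta P) =
      (\<Sum>A\<in>D ?S. frag_cmul (t_eps (restr P (?S - A))) (frag_of (restr P A)))"
    by (simp add: split_delta_def frag_extend_sum_of)
  also have "\<dots> = (\<Sum>A\<in>D ?S. if A = ?S then frag_of P else 0)"
  proof (intro sum.cong refl)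
    fix A assume "A \<in> D ?S"
    then have "?S - A = {} \<longleftrightarrow> A = ?S" using subset by blast
    then show "frag_cmul (t_eps (restr P (?S - A))) (frag_of (restr P A)) =
        (if A = ?S then frag_of P else 0)"
      using restr_eq_Nil[OF P, of "?S - A"] full_P by (auto simp: t_eps_def)
  qed
  also have "\<dots> = frag_of P"
    using full finite_D[of ?S] by simp
  finally show "frag_extend (\<lambda>(b, c). frag_cmul (t_eps c) (frag_of b)) (split_delta P) = frag_of P" .
qed

text \<open>Once standardization is removed, both sides run over ordered splittings of the ground
  set into three parts. A chain \<open>(A, B)\<close> corresponds to the pair
  \<open>(B, A - B)\<close> of first and middle part.\<close>

lemma split_delta_coassoc:
  assumes P: "P \<in> Comps"
  shows "frag_extend (\<lambda>(b, c). frag_extend (\<lambda>(b1, b2). frag_of (b1, b2, c)) (split_delta b)) (split_delta P)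
    = frag_extend (\<lambda>(b, c). frag_extend (\<lambda>(c1, c2). frag_of (b, c1, c2)) (split_delta c)) (split_delta P)"
proof -
  let ?S = "{1..cdeg P}"
  have fin: "finite ?S" by simp
  have "frag_extend (\<lambda>(b, c). frag_extend (\<lambda>(b1, b2). frag_of (b1, b2, c)) (split_delta b)) (split_delta P)
    = (\<Sum>A\<in>D ?S. frag_extend (\<lambda>(b1, b2). frag_of (b1, b2, restr P (?S - A))) (split_delta (restr P A)))"
    by (simp add: split_delta_def[of P] frag_extend_sum_of)
  also have "\<dots> = (\<Sum>A\<in>D ?S. \<Sum>B\<in>D A. frag_of (restr P B, restr P (A - B), restr P (?S - A)))"
    by (intro sum.cong refl) (simp add: split_delta_restr[OF P subset] frag_extend_sum_of)
  also have "\<dots> = (\<Sum>(A, B)\<in>Sigma (D ?S) D. frag_of (restr P B, restr P (A - B), restr P (?S - A)))"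
    using finite_D subset finite_subset[OF _ fin] by (subst sum.Sigma) auto
  also have "\<dots> = (\<Sum>(B, C)\<in>(SIGMA B:D ?S. D (?S - B)). frag_of (restr P B, restr P C, restr P (?S - B - C)))"
  proof (rule sum.reindex_bij_witness[where i = "\<lambda>(B, C). (B \<union> C, B)" and j = "\<lambda>(A, B). (B, A - B)"])
    fix x assume "x \<in> Sigma (D ?S) D"
    then obtain A B where x: "x = (A, B)" "A \<in> D ?S" "B \<in> D A" by blast
    then have sub: "B \<subseteq> A" "A \<subseteq> ?S" using subset by blast+
    show "(case case x of (A, B) \<Rightarrow> (B, A - B) of (B, C) \<Rightarrow> (B \<union> C, B)) = x"
      using x sub by auto
    show "(case x of (A, B) \<Rightarrow> (B, A - B)) \<in> (SIGMA B:D ?S. D (?S - B))"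
      using x sub coassoc[of B A ?S] by auto
    have "?S - B - (A - B) = ?S - A" using sub by blast
    then show "(case case x of (A, B) \<Rightarrow> (B, A - B) of
        (B, C) \<Rightarrow> frag_of (restr P B, restr P C, restr P (?S - B - C))) =
      (case x of (A, B) \<Rightarrow> frag_of (restr P B, restr P (A - B), restr P (?S - A)))"
      using x by simp
  next
    fix y assume "y \<in> (SIGMA B:D ?S. D (?S - B))"
    then obtain B C where y: "y = (B, C)" "B \<in> D ?S" "C \<in> D (?S - B)" by blast
    then have sub: "B \<subseteq> ?S" "C \<subseteq> ?S - B" using subset by blast+
    then have BC: "B \<union> C - B = C" by blast
    show "(case case y of (B, C) \<Rightarrow> (B \<union> C, B) of (A, B) \<Rightarrow> (B, A - B)) = y"
      using y BC by simp
    show "(case y of (B, C) \<Rightarrow> (B \<union> C, B)) \<in> Sigma (D ?S) D"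
      using y sub coassoc[of B "B \<union> C" ?S] BC by auto
  qed
  also have "\<dots> = (\<Sum>B\<in>D ?S. \<Sum>C\<in>D (?S - B). frag_of (restr P B, restr P C, restr P (?S - B - C)))"
    using finite_D by (subst sum.Sigma) auto
  also have "\<dots> = (\<Sum>B\<in>D ?S. frag_extend (\<lambda>(c1, c2). frag_of (restr P B, c1, c2)) (split_delta (restr P (?S - B))))"
    by (intro sum.cong refl) (simp add: split_delta_restr[OF P Diff_subset] frag_extend_sum_of)
  also have "\<dots> = frag_extend (\<lambda>(b, c). frag_extend (\<lambda>(c1, c2). frag_of (b, c1, c2)) (split_delta c)) (split_delta P)"
    by (simp add: split_delta_def[of P] frag_extend_sum_of)
  finally show ?thesis .
qed

end

section \<open>All subsets and lower sets as families of splittings\<close>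

interpretation all_splits: split_family Pow
proof
  show "f ` A \<in> Pow (f ` S) \<longleftrightarrow> A \<in> Pow S" if "A \<subseteq> S" for f :: "nat \<Rightarrow> nat" and A S
    using that by blast
qed auto

lemma hat_delta_split: "hat_delta P = all_splits.split_delta P"
  by (simp add: hat_delta_def all_splits.split_delta_def)

text \<open>Formulated for arbitrary ground sets instead of intervals \<open>{1..p}\<close>, since
  the second splitting takes place inside a part that is not standardized.\<close>

definition lower_sets :: "nat set \<Rightarrow> nat set set" where
  "lower_sets S = {A. A \<subseteq> S \<and> (\<forall>x\<in>A. \<forall>y\<in>S. y < x \<longrightarrow> y \<in> A)}"

interpretation lower_splits: split_family lower_sets
proof
  fix A S :: "nat set" and f :: "nat \<Rightarrow> nat"
  assume "strict_mono_on S f" "A \<subseteq> S"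
  moreover from this have "f y < f x \<longleftrightarrow> y < x" if "x \<in> A" "y \<in> S" for x y
    using that strict_mono_on_less[of S f y x] by blast
  moreover have "f y \<in> f ` A \<longleftrightarrow> y \<in> A" if "y \<in> S" for y
    using that inj_on_image_mem_iff[OF strict_mono_on_imp_inj_on] calculation(1,2) by metis
  ultimately show "f ` A \<in> lower_sets (f ` S) \<longleftrightarrow> A \<in> lower_sets S"
    unfolding lower_sets_def by auto
next
  fix A B S :: "nat set"
  assume "B \<subseteq> A" "A \<subseteq> S"
  then show "A \<in> lower_sets S \<and> B \<in> lower_sets A \<longleftrightarrow> B \<in> lower_sets S \<and> A - B \<in> lower_sets (S - B)"
    unfolding lower_sets_def by (auto; (metis DiffI nat_neq_iff subsetD)?)
qed (auto simp: lower_sets_def)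

text \<open>A nonempty lower set is the interval up to its maximum; \<open>p = 0\<close> accounts
  for the empty one.\<close>

lemma lower_sets_initial: "lower_sets {1..n} = (\<lambda>p. {1..p}) ` {0..n}"
proof (intro equalityI subsetI)
  fix A assume A: "A \<in> lower_sets {1..n}"
  show "A \<in> (\<lambda>p. {1..p}) ` {0..n}"
  proof (cases "A = {}")
    case True then show ?thesis by (auto intro!: image_eqI[of _ _ 0])
  next
    case False
    have fin: "finite A" using A by (auto simp: lower_sets_def intro: finite_subset)
    then have "Max A \<in> A" using False by simp
    then have m: "Max A \<in> {1..n}" using A unfolding lower_sets_def by blast
    have "A = {1..Max A}"
    proof (intro equalityI subsetI)
      fix x assume "x \<in> A"
      then show "x \<in> {1..Max A}" using A fin unfolding lower_sets_def by auto
    next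
      fix x assume "x \<in> {1..Max A}"
      then have "x = Max A \<or> x < Max A \<and> x \<in> {1..n}" using m by auto
      then show "x \<in> A" using A \<open>Max A \<in> A\<close> unfolding lower_sets_def by blast
    qed
    then show ?thesis using m by (intro image_eqI[of _ _ "Max A"]) auto
  qed
qed (auto simp: lower_sets_def)

lemma bar_delta_split: "bar_delta P = lower_splits.split_delta P"
proof -
  have "{1..cdeg P} - {1..p} = {p + 1..cdeg P}" for p by auto
  moreover have "inj_on (\<lambda>p. {1..p}) {0..cdeg P}"
    by (rule inj_on_inverseI[of _ card]) simp
  ultimately show ?thesis
    by (simp add: bar_delta_def lower_splits.split_delta_def lower_sets_initial sum.reindex)
qed

subsection \<open>The shuffle product\<close>

lemma strict_mono_on_unique:
  fixes f g :: "nat \<Rightarrow> nat"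
  assumes "finite S" "strict_mono_on S f" "strict_mono_on S g" "f ` S = g ` S" "x \<in> S"
  shows "f x = g x"
  using ord_iso_image_eq[OF assms(1,2,5)] ord_iso_image_eq[OF assms(1,3,5)] assms(4) by simp

lemma ord_iso_inverse:
  assumes fin: "finite S" "finite T" and card: "card S = card T" and x: "x \<in> S"
  shows "ord_iso T S (ord_iso S T x) = x"
proof (rule strict_mono_on_unique[OF fin(1) _ strict_mono_on_id _ x])
  show "strict_mono_on S (\<lambda>x. ord_iso T S (ord_iso S T x))"
    using ord_iso_strict_mono_image[OF fin card] ord_iso_strict_mono_image[OF fin(2,1) card[symmetric]]
    by (intro strict_mono_on_comp[of S "ord_iso S T" "ord_iso T S"]) simp_all
  show "(\<lambda>x. ord_iso T S (ord_iso S T x)) ` S = (\<lambda>x. x) ` S"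
    using ord_iso_strict_mono_image(2)[OF fin card]
      ord_iso_strict_mono_image(2)[OF fin(2,1) card[symmetric]]
    by (simp flip: image_image)
qed

lemma is_setcomp_is_map:
  assumes "finite S" "finite T" "card S = card T" "is_setcomp S P"
  shows "is_setcomp T (is_map S T P)"
  using is_setcomp_relabel[OF assms(4) strict_mono_on_imp_inj_on, of "ord_iso S T"]
    ord_iso_strict_mono_image[OF assms(1-3)]
  by (simp add: is_map_ord_iso)

lemma is_map_id: "is_setcomp S P \<Longrightarrow> finite S \<Longrightarrow> is_map S S P = P"
  using is_map_relabel[of S "\<lambda>x. x" S P] by (simp add: strict_mono_on_id is_setcomp_Union relabel_id)

lemma length_is_map [simp]: "length (is_map S T P) = length P"
  by (simp add: is_map_def)

lemma length_std [simp]: "length (std P) = length P"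
  by (simp add: std_def)

lemma std_eq_stdz: "std P = relabel (stdz (\<Union>(set P))) P"
  by (simp add: std_def is_map_ord_iso)

lemma std_Comps: "P \<in> Comps \<Longrightarrow> std P = P"
  using CompsD[of P] is_map_id[of "{1..cdeg P}" P]
  by (simp add: std_def is_setcomp_Union)

lemma is_setcomp_std:
  assumes "is_setcomp S P" "finite S"
  shows "is_setcomp {1..card S} (std P)"
  using is_setcomp_is_map[of S "{1..card S}" P] assms by (simp add: std_def is_setcomp_Union)

lemma std_relabel:
  assumes fin: "finite (\<Union>(set P))" and f: "strict_mono_on (\<Union>(set P)) f"
  shows "std (relabel f P) = std P"
proof -
  let ?S = "\<Union>(set P)" and ?T = "f ` \<Union>(set P)"
  have card: "card ?T = card ?S" using f strict_mono_on_imp_inj_on card_image by blast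
  have fT: "finite ?T" using fin by simp
  have "std (relabel f P) = relabel (\<lambda>x. stdz ?T (f x)) P"
    by (simp only: std_eq_stdz Union_relabel relabel_relabel)
  also have "\<dots> = is_map ?S {1..card ?S} P"
  proof (rule is_map_relabel[symmetric, OF fin])
    show "strict_mono_on ?S (\<lambda>x. stdz ?T (f x))"
      by (rule strict_mono_on_comp[OF f stdz_strict_mono[OF fT]])
    show "(\<lambda>x. stdz ?T (f x)) ` ?S = {1..card ?S}"
      using stdz_image[OF fT] card by (simp flip: image_image)
  qed simp
  finally show ?thesis by (simp add: std_def)
qed

lemma std_is_map:
  assumes "finite S" "finite T" "card S = card T" "\<Union>(set P) = S"
  shows "std (is_map S T P) = std P"
  using std_relabel[of P "ord_iso S T"] ord_iso_strict_mono_image[OF assms(1-3)] assms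
  by (simp add: is_map_ord_iso)

text \<open>A set composition is recovered from its ground set and its standardization. This makes
  the terms of a shuffle correspond bijectively to ground sets.\<close>

lemma is_map_std:
  assumes "finite S" "\<Union>(set P) = S"
  shows "is_map {1..card S} S (std P) = P"
proof -
  have "is_map {1..card S} S (std P) = relabel (\<lambda>x. ord_iso {1..card S} S (stdz S x)) P"
    using assms by (simp add: std_eq_stdz is_map_ord_iso image_image)
  also have "\<dots> = P"
    using assms by (intro relabel_id ord_iso_inverse) auto
  finally show ?thesis .
qed

lemma take_drop_setcomp:
  assumes "is_setcomp S P"
  obtains A B where "is_setcomp A (take k P)" "is_setcomp B (drop k P)" "A \<inter> B = {}" "A \<union> B = S"
  using assms is_setcomp_append[of S "take k P" "drop k P"] by auto

lemma is_setcomp_take: "is_setcomp S P \<Longrightarrow> is_setcomp (\<Union>(set (take k P))) (take k P)"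
  by (erule take_drop_setcomp[of _ _ k]) (simp only: is_setcomp_Union)

lemma is_setcomp_drop: "is_setcomp S P \<Longrightarrow> is_setcomp (\<Union>(set (drop k P))) (drop k P)"
  by (erule take_drop_setcomp[of _ _ k]) (simp only: is_setcomp_Union)

lemma Union_take_drop:
  assumes "is_setcomp S P"
  shows "\<Union>(set (take k P)) \<union> \<Union>(set (drop k P)) = S"
    "\<Union>(set (take k P)) \<inter> \<Union>(set (drop k P)) = {}"
  by (rule take_drop_setcomp[OF assms, of k]; simp only: is_setcomp_Union)+

text \<open>On the first \<open>k\<close> blocks, standardizing the whole is just some strictly
  monotone relabelling, which the outer standardization absorbs.\<close>

lemma std_take_std:
  assumes "finite (\<Union>(set P))" shows "std (take k (std P)) = std (take k P)"
proof -
  have sub: "\<Union>(set (take k P)) \<subseteq> \<Union>(set P)" by (auto dest: in_set_takeD)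
  show ?thesis
    unfolding std_eq_stdz[of P] take_map
    by (intro std_relabel monotone_on_subset[OF stdz_strict_mono sub] finite_subset[OF sub] assms)
qed

lemma std_drop_std:
  assumes "finite (\<Union>(set P))" shows "std (drop k (std P)) = std (drop k P)"
proof -
  have sub: "\<Union>(set (drop k P)) \<subseteq> \<Union>(set P)" by (auto dest: in_set_dropD)
  show ?thesis
    unfolding std_eq_stdz[of P] drop_map
    by (intro std_relabel monotone_on_subset[OF stdz_strict_mono sub] finite_subset[OF sub] assms)
qed

text \<open>Disjoint nonempty blocks are distinct, so the length is bounded by the number of subsets
  of the ground set.\<close>

lemma finite_Comp: "finite (Comp n)"
proof (rule finite_subset)
  show "Comp n \<subseteq> {P. set P \<subseteq> Pow {1..n} \<and> length P \<le> card (Pow {1..n})}"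
  proof clarify
    fix P assume "P \<in> Comp n"
    then have P: "is_setcomp {1..n} P" by (simp add: Comp_def)
    then have sub: "set P \<subseteq> Pow {1..n}" unfolding is_setcomp_iff by blast
    have "distinct P"
      unfolding distinct_conv_nth
    proof (intro allI impI notI)
      fix i j assume "i < length P" "j < length P" "i \<noteq> j" "P ! i = P ! j"
      then have "P ! i \<inter> P ! j = {}" using P unfolding is_setcomp_def by blast
      moreover have "P ! i \<in> set P" using \<open>i < length P\<close> by simp
      ultimately show False using P \<open>P ! i = P ! j\<close> unfolding is_setcomp_def by auto
    qed
    then have "length P = card (set P)" by (simp add: distinct_card)
    also have "\<dots> \<le> card (Pow {1..n})" using sub by (intro card_mono) auto
    finally show "set P \<subseteq> Pow {1..n} \<and> length P \<le> card (Pow {1..n})" using sub by blast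
  qed
  show "finite {P. set P \<subseteq> Pow {1..n} \<and> length P \<le> card (Pow {1..n})}"
    by (rule finite_lists_length_le) simp
qed

section \<open>The shuffle product indexed by its terms\<close>

text \<open>The \<open>R\<close> for which the coproduct of \<open>M R\<close> in NCQsym contains
  the pair \<open>(P, Q)\<close>. One cut suffices because standardization preserves the number of
  blocks; an \<open>R\<close> with fewer than \<open>length P\<close> blocks is excluded by the
  first equation.\<close>

definition glued :: "scomp \<Rightarrow> scomp \<Rightarrow> scomp set" where
  "glued P Q = {R \<in> Comp (cdeg P + cdeg Q).
     std (take (length P) R) = P \<and> std (drop (length P) R) = Q}"

lemma finite_glued: "finite (glued P Q)"
  unfolding glued_def using finite_Comp by simp

definition shuffle :: "scomp \<Rightarrow> scomp \<Rightarrow> nat set \<Rightarrow> scomp" where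
  "shuffle P Q A = is_map {1..cdeg P} A P @ is_map {1..cdeg Q} ({1..cdeg P + cdeg Q} - A) Q"

lemma hat_mult_shuffle:
  "hat_mult P Q = (\<Sum>A | A \<subseteq> {1..cdeg P + cdeg Q} \<and> card A = cdeg P. frag_of (shuffle P Q A))"
  by (simp add: hat_mult_def shuffle_def)

lemma card_compl_shuffle:
  "A \<subseteq> {1..p + q} \<Longrightarrow> card A = p \<Longrightarrow> card ({1..p + q} - A) = q" for A :: "nat set"
  by (simp add: card_Diff_subset finite_subset)

lemma shuffle_Comp:
  assumes "P \<in> Comps" "Q \<in> Comps" "A \<subseteq> {1..cdeg P + cdeg Q}" "card A = cdeg P"
  shows "is_setcomp A (is_map {1..cdeg P} A P)"
    and "is_setcomp ({1..cdeg P + cdeg Q} - A) (is_map {1..cdeg Q} ({1..cdeg P + cdeg Q} - A) Q)"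
    and "shuffle P Q A \<in> Comp (cdeg P + cdeg Q)"
proof -
  have fin: "finite A" using assms(3) by (rule finite_subset) simp
  show 1: "is_setcomp A (is_map {1..cdeg P} A P)"
    using fin assms CompsD by (intro is_setcomp_is_map) auto
  show 2: "is_setcomp ({1..cdeg P + cdeg Q} - A) (is_map {1..cdeg Q} ({1..cdeg P + cdeg Q} - A) Q)"
    using card_compl_shuffle[OF assms(3,4)] assms CompsD by (intro is_setcomp_is_map) auto
  show "shuffle P Q A \<in> Comp (cdeg P + cdeg Q)"
    unfolding shuffle_def Comp_def mem_Collect_eq is_setcomp_append
    using 1 2 assms(3) by blast
qed

text \<open>The set \<open>A\<close> is the union of the first \<open>length P\<close> blocks of its
  shuffle term, and each half is determined by its ground set and its standardization. Hence no term
  occurs twice and all coefficients are 1.\<close>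

lemma hat_mult_glued:
  assumes P: "P \<in> Comps" and Q: "Q \<in> Comps"
  shows "hat_mult P Q = (\<Sum>R\<in>glued P Q. frag_of R)"
  unfolding hat_mult_shuffle
proof (rule sum.reindex_bij_witness[where i = "\<lambda>R. \<Union>(set (take (length P) R))" and j = "shuffle P Q"])
  fix A assume "A \<in> {A. A \<subseteq> {1..cdeg P + cdeg Q} \<and> card A = cdeg P}"
  then have A: "A \<subseteq> {1..cdeg P + cdeg Q}" "card A = cdeg P" by auto
  have fin: "finite A" using A(1) by (rule finite_subset) simp
  have tk: "take (length P) (shuffle P Q A) = is_map {1..cdeg P} A P"
    "drop (length P) (shuffle P Q A) = is_map {1..cdeg Q} ({1..cdeg P + cdeg Q} - A) Q"
    by (simp_all add: shuffle_def)
  show "\<Union>(set (take (length P) (shuffle P Q A))) = A"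
    unfolding tk using shuffle_Comp(1)[OF P Q A] by (rule is_setcomp_Union)
  have "std (is_map {1..cdeg P} A P) = P"
    using std_is_map[of "{1..cdeg P}" A P] fin A P CompsD[OF P] by (simp add: is_setcomp_Union std_Comps)
  moreover have "std (is_map {1..cdeg Q} ({1..cdeg P + cdeg Q} - A) Q) = Q"
    using std_is_map[of "{1..cdeg Q}" "{1..cdeg P + cdeg Q} - A" Q] card_compl_shuffle[OF A] Q CompsD[OF Q]
    by (simp add: is_setcomp_Union std_Comps)
  ultimately show "shuffle P Q A \<in> glued P Q"
    using shuffle_Comp(3)[OF P Q A] by (simp add: glued_def tk)
next
  fix R assume "R \<in> glued P Q"
  then have R: "is_setcomp {1..cdeg P + cdeg Q} R"
    and std: "std (take (length P) R) = P" "std (drop (length P) R) = Q"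
    by (auto simp: glued_def Comp_def)
  let ?A = "\<Union>(set (take (length P) R))" and ?B = "\<Union>(set (drop (length P) R))"
  have AB: "?A \<union> ?B = {1..cdeg P + cdeg Q}" "?A \<inter> ?B = {}" by (rule Union_take_drop[OF R])+
  have fin: "finite ?A" "finite ?B"
    using finite_subset[of _ "{1..cdeg P + cdeg Q}"] AB(1) by (metis finite_Un finite_atLeastAtMost)+
  have cA: "cdeg P = card ?A"
    using is_setcomp_cdeg[OF is_setcomp_std[OF is_setcomp_take[OF R] fin(1)]] std by simp
  have cB: "cdeg Q = card ?B"
    using is_setcomp_cdeg[OF is_setcomp_std[OF is_setcomp_drop[OF R] fin(2)]] std by simp
  show "?A \<in> {A. A \<subseteq> {1..cdeg P + cdeg Q} \<and> card A = cdeg P}"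
    using AB cA by auto
  have "{1..cdeg P + cdeg Q} - ?A = ?B" using AB by blast
  then have "shuffle P Q ?A = is_map {1..card ?A} ?A (std (take (length P) R)) @
      is_map {1..card ?B} ?B (std (drop (length P) R))"
    unfolding shuffle_def using std cA cB by simp
  also have "\<dots> = R"
    using is_map_std[OF fin(1) refl] is_map_std[OF fin(2) refl] by simp
  finally show "shuffle P Q ?A = R" .
qed auto

lemma glued_length:
  assumes "R \<in> glued P Q" shows "length R = length P + length Q"
proof -
  have "length (take (length P) R) = length P" "length (drop (length P) R) = length Q"
    using assms length_std[of "take (length P) R"] length_std[of "drop (length P) R"]
    unfolding glued_def by (simp_all del: length_std)
  then show ?thesis by simp
qed

lemma std_parts_cdeg:
  assumes "is_setcomp S R" "finite S"
  shows "card (\<Union>(set (take k R))) = cdeg (std (take k R))"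
    and "card (\<Union>(set (drop k R))) = cdeg (std (drop k R))"
    and "finite (\<Union>(set (take k R)))" "finite (\<Union>(set (drop k R)))"
proof -
  show fin: "finite (\<Union>(set (take k R)))" "finite (\<Union>(set (drop k R)))"
    using Union_take_drop(1)[OF assms(1)] assms(2) by (metis finite_Un)+
  show "card (\<Union>(set (take k R))) = cdeg (std (take k R))"
    using is_setcomp_cdeg[OF is_setcomp_std[OF is_setcomp_take[OF assms(1)] fin(1)]] by simp
  show "card (\<Union>(set (drop k R))) = cdeg (std (drop k R))"
    using is_setcomp_cdeg[OF is_setcomp_std[OF is_setcomp_drop[OF assms(1)] fin(2)]] by simp
qed

text \<open>The degree condition in \<open>glued\<close> is automatic: the two runs of blocks have
  disjoint ground sets, whose sizes are the degrees of their standardizations.\<close>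

lemma gluedI:
  assumes "is_setcomp {1..n} R" "std (take (length P) R) = P" "std (drop (length P) R) = Q"
  shows "R \<in> glued P Q"
proof -
  have "n = card (\<Union>(set (take (length P) R)) \<union> \<Union>(set (drop (length P) R)))"
    using Union_take_drop(1)[OF assms(1)] by simp
  also have "\<dots> = cdeg P + cdeg Q"
    using Union_take_drop(2)[OF assms(1)] std_parts_cdeg[OF assms(1)] assms(2,3)
    by (simp add: card_Un_disjoint)
  finally show ?thesis using assms by (simp add: glued_def Comp_def)
qed

section \<open>Associativity of the shuffle product\<close>

text \<open>The common index set of both bracketings of a triple product: three consecutive runs of
  blocks with prescribed standardizations.\<close>

definition glued3 :: "scomp \<Rightarrow> scomp \<Rightarrow> scomp \<Rightarrow> scomp set" where
  "glued3 P Q S = {R \<in> Comp (cdeg P + cdeg Q + cdeg S). std (take (length P) R) = P \<and>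
     std (take (length Q) (drop (length P) R)) = Q \<and> std (drop (length P + length Q) R) = S}"

text \<open>The intermediate factor \<open>T\<close> is no extra datum, being the standardization of
  the first \<open>length P + length Q\<close> blocks of \<open>R\<close>. The double sum therefore
  meets each \<open>R\<close> once.\<close>

lemma glued3_left:
  "(\<Sum>T\<in>glued P Q. \<Sum>R\<in>glued T S. frag_of R) = (\<Sum>R\<in>glued3 P Q S. frag_of R)"
proof -
  have "(\<Sum>T\<in>glued P Q. \<Sum>R\<in>glued T S. frag_of R) = (\<Sum>(T, R)\<in>(SIGMA T:glued P Q. glued T S). frag_of R)"
    by (simp add: sum.Sigma finite_glued)
  also have "\<dots> = (\<Sum>R\<in>glued3 P Q S. frag_of R)"
  proof (rule sum.reindex_bij_witness[where j = snd and
        i = "\<lambda>R. (std (take (length P + length Q) R), R)"])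
    fix x assume "x \<in> (SIGMA T:glued P Q. glued T S)"
    then obtain T R where x: "x = (T, R)" "T \<in> glued P Q" "R \<in> glued T S" by blast
    have len: "length T = length P + length Q" using glued_length[OF x(2)] .
    have R: "is_setcomp {1..cdeg T + cdeg S} R" "std (take (length P + length Q) R) = T"
      "std (drop (length P + length Q) R) = S"
      using x(3) len by (auto simp: glued_def Comp_def)
    have T: "std (take (length P) T) = P" "std (drop (length P) T) = Q" "cdeg T = cdeg P + cdeg Q"
      using x(2) Comp_iff by (auto simp: glued_def)
    show "(std (take (length P + length Q) (snd x)), snd x) = x"
      using x R by simp
    have "std (take (length P) R) = P"
      using std_take_std[OF std_parts_cdeg(3)[OF R(1)], of "length P" "length P + length Q"] R T by simp
    moreover have "std (take (length Q) (drop (length P) R)) = Q"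
      using std_drop_std[OF std_parts_cdeg(3)[OF R(1)], of "length P" "length P + length Q"] R T
      by (simp add: drop_take)
    ultimately show "snd x \<in> glued3 P Q S"
      using x R T by (simp add: glued3_def Comp_def)
    show "frag_of (snd x) = (case x of (T, R) \<Rightarrow> frag_of R)" using x by simp
  next
    fix R assume "R \<in> glued3 P Q S"
    then have R: "is_setcomp {1..cdeg P + cdeg Q + cdeg S} R" "std (take (length P) R) = P"
     "std (take (length Q) (drop (length P) R)) = Q" "std (drop (length P + length Q) R) = S"
      by (auto simp: glued3_def Comp_def)
    let ?T = "std (take (length P + length Q) R)"
    have T: "is_setcomp {1..card (\<Union>(set (take (length P + length Q) R)))} ?T"
      by (rule is_setcomp_std[OF is_setcomp_take[OF R(1)] std_parts_cdeg(3)[OF R(1)]]) simp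
    have "std (take (length P) ?T) = P" "std (drop (length P) ?T) = Q"
      using std_take_std[OF std_parts_cdeg(3)[OF R(1)], of "length P" "length P + length Q"]
        std_drop_std[OF std_parts_cdeg(3)[OF R(1)], of "length P" "length P + length Q"] R
      by (simp_all add: drop_take)
    then have T_glued: "?T \<in> glued P Q" using T by (intro gluedI)
    then have "length ?T = length P + length Q" by (rule glued_length)
    then have "R \<in> glued ?T S"
      using R by (intro gluedI[OF R(1)]) simp_all
    then show "(?T, R) \<in> (SIGMA T:glued P Q. glued T S)" using T_glued by blast
  qed simp
  finally show ?thesis .
qed

text \<open>Mirror image: here the intermediate factor is the standardization of the blocks after
  the first \<open>length P\<close>.\<close>

lemma glued3_right:
  "(\<Sum>T\<in>glued Q S. \<Sum>R\<in>glued P T. frag_of R) = (\<Sum>R\<in>glued3 P Q S. frag_of R)"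
proof -
  have "(\<Sum>T\<in>glued Q S. \<Sum>R\<in>glued P T. frag_of R) = (\<Sum>(T, R)\<in>(SIGMA T:glued Q S. glued P T). frag_of R)"
    by (simp add: sum.Sigma finite_glued)
  also have "\<dots> = (\<Sum>R\<in>glued3 P Q S. frag_of R)"
  proof (rule sum.reindex_bij_witness[where j = snd and i = "\<lambda>R. (std (drop (length P) R), R)"])
    fix x assume "x \<in> (SIGMA T:glued Q S. glued P T)"
    then obtain T R where x: "x = (T, R)" "T \<in> glued Q S" "R \<in> glued P T" by blast
    have R: "is_setcomp {1..cdeg P + cdeg T} R" "std (take (length P) R) = P"
      "std (drop (length P) R) = T"
      using x(3) by (auto simp: glued_def Comp_def)
    have T: "std (take (length Q) T) = Q" "std (drop (length Q) T) = S" "cdeg T = cdeg Q + cdeg S"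
      using x(2) Comp_iff by (auto simp: glued_def)
    show "(std (drop (length P) (snd x)), snd x) = x"
      using x R by simp
    have "std (take (length Q) (drop (length P) R)) = Q"
      using std_take_std[OF std_parts_cdeg(4)[OF R(1)], of "length Q" "length P"] R T by simp
    moreover have "std (drop (length P + length Q) R) = S"
      using std_drop_std[OF std_parts_cdeg(4)[OF R(1)], of "length Q" "length P"] R T
      by (simp add: add.commute)
    ultimately show "snd x \<in> glued3 P Q S"
      using x R T by (simp add: glued3_def Comp_def add.assoc)
    show "frag_of (snd x) = (case x of (T, R) \<Rightarrow> frag_of R)" using x by simp
  next
    fix R assume "R \<in> glued3 P Q S"
    then have R: "is_setcomp {1..cdeg P + cdeg Q + cdeg S} R" "std (take (length P) R) = P"
     "std (take (length Q) (drop (length P) R)) = Q" "std (drop (length P + length Q) R) = S"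
      by (auto simp: glued3_def Comp_def)
    let ?T = "std (drop (length P) R)"
    have T: "is_setcomp {1..card (\<Union>(set (drop (length P) R)))} ?T"
      by (rule is_setcomp_std[OF is_setcomp_drop[OF R(1)] std_parts_cdeg(4)[OF R(1)]]) simp
    have "std (take (length Q) ?T) = Q" "std (drop (length Q) ?T) = S"
      using std_take_std[OF std_parts_cdeg(4)[OF R(1)], of "length Q" "length P"]
        std_drop_std[OF std_parts_cdeg(4)[OF R(1)], of "length Q" "length P"] R
      by (simp_all add: add.commute)
    then have T_glued: "?T \<in> glued Q S" using T by (intro gluedI)
    moreover have "R \<in> glued P ?T"
      using R by (intro gluedI[OF R(1)]) simp_all
    ultimately show "(?T, R) \<in> (SIGMA T:glued Q S. glued P T)" by blast
  qed simp
  finally show ?thesis .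
qed

lemma glued_Comps: "R \<in> glued P Q \<Longrightarrow> R \<in> Comps" "R \<in> glued P Q \<Longrightarrow> cdeg R = cdeg P + cdeg Q"
  by (auto simp: glued_def Comp_iff)

lemma hat_mult_assoc:
  assumes P: "P \<in> Comps" and Q: "Q \<in> Comps" and S: "S \<in> Comps"
  shows "mult_ext hat_mult (hat_mult P Q) (frag_of S) = mult_ext hat_mult (frag_of P) (hat_mult Q S)"
proof -
  have "mult_ext hat_mult (hat_mult P Q) (frag_of S) = (\<Sum>T\<in>glued P Q. hat_mult T S)"
    by (simp add: hat_mult_glued[OF P Q] mult_ext_def frag_extend_sum_of)
  also have "\<dots> = (\<Sum>T\<in>glued P Q. \<Sum>R\<in>glued T S. frag_of R)"
    by (intro sum.cong refl hat_mult_glued glued_Comps S)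
  also have "\<dots> = (\<Sum>T\<in>glued Q S. \<Sum>R\<in>glued P T. frag_of R)"
    by (simp only: glued3_left glued3_right)
  also have "\<dots> = (\<Sum>T\<in>glued Q S. hat_mult P T)"
    by (intro sum.cong refl hat_mult_glued[symmetric] glued_Comps P)
  also have "\<dots> = mult_ext hat_mult (frag_of P) (hat_mult Q S)"
    by (simp add: hat_mult_glued[OF Q S] mult_ext_def frag_extend_sum_of)
  finally show ?thesis .
qed

lemma hat_mult_keys:
  assumes "P \<in> Comps" "Q \<in> Comps"
  shows "Poly_Mapping.keys (hat_mult P Q) \<subseteq> glued P Q"
  using keys_sum_frag_of[of "\<lambda>R. R" "glued P Q"] by (simp add: hat_mult_glued assms)

lemma hat_mult_Nil:
  assumes "P \<in> Comps"
  shows "hat_mult [] P = frag_of P" "hat_mult P [] = frag_of P"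
proof -
  have "glued [] P = {P}"
    using assms by (auto simp: glued_def Comp_iff std_Comps std_def[of "[]"] is_map_def)
  then show "hat_mult [] P = frag_of P" by (simp add: hat_mult_glued assms)
  have "glued P [] = {P}"
  proof (intro equalityI subsetI)
    fix R assume R: "R \<in> glued P []"
    then have "length R = length P" using glued_length by fastforce
    then show "R \<in> {P}" using R by (auto simp: glued_def Comp_iff std_Comps)
  qed (use assms in \<open>simp add: glued_def Comp_iff std_Comps std_def[of "[]"] is_map_def\<close>)
  then show "hat_mult P [] = frag_of P" by (simp add: hat_mult_glued assms)
qed

lemma hat_mult_counit:
  assumes "P \<in> Comps" "Q \<in> Comps"
  shows "counit_ext t_eps (hat_mult P Q) = t_eps P * t_eps Q"
proof (cases "P = [] \<or> Q = []")
  case True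
  then show ?thesis using assms by (auto simp: t_eps_def hat_mult_Nil)
next
  case False
  then have "t_eps R = 0" if "R \<in> glued P Q" for R
    using glued_length[OF that] by (auto simp: t_eps_def)
  then show ?thesis
    using False by (simp add: hat_mult_glued assms counit_ext_sum_of t_eps_def)
qed

subsection \<open>Compatibility of products and coproducts\<close>

text \<open>The order isomorphism after \<open>stdz C\<close> is strictly monotone on
  \<open>C\<close> with the same image as \<open>f\<close>, hence equal to \<open>f\<close>. In this
  way a relabelled trace is rewritten as a relocated restriction, the shape of the factors in
  \<open>shuffle\<close>.\<close>

lemma is_map_restr:
  assumes fin: "finite C" and f: "strict_mono_on C f"
  shows "is_map {1..card C} (f ` C) (restr P C) = relabel f (trace P C)"
proof -
  have cf: "card (f ` C) = card C"
    using f strict_mono_on_imp_inj_on card_image by blast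
  note o = ord_iso_strict_mono_image[of "{1..card C}" "f ` C"]
  have sm: "strict_mono_on C (\<lambda>x. ord_iso {1..card C} (f ` C) (stdz C x))"
    using fin cf o(1) stdz_image[OF fin]
    by (intro strict_mono_on_comp[OF stdz_strict_mono[OF fin]]) simp
  have im: "(\<lambda>x. ord_iso {1..card C} (f ` C) (stdz C x)) ` C = f ` C"
    using fin cf o(2) stdz_image[OF fin] by (simp flip: image_image)
  have "is_map {1..card C} (f ` C) (restr P C) =
      relabel (\<lambda>x. ord_iso {1..card C} (f ` C) (stdz C x)) (trace P C)"
    by (simp only: is_map_ord_iso restr_stdz relabel_relabel)
  also have "\<dots> = relabel f (trace P C)"
    by (rule relabel_cong) (use strict_mono_on_unique[OF fin sm f im] in \<open>simp add: Union_trace\<close>)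
  finally show ?thesis .
qed

text \<open>Common source of both compatibilities. The maps \<open>g\<close> and \<open>h\<close>
  place the factors on disjoint sets: by the identity and a shift for \<open>bar_mult\<close>, by
  the order isomorphisms onto \<open>A\<close> and its complement for \<open>hat_mult\<close>.
  Disjointness lets each factor see only its own part of the restricting set, and \<open>k\<close>
  is any standardization of that set.\<close>

lemma restr_append_relabel:
  assumes P: "is_setcomp S P" and Q: "is_setcomp T Q"
    and g: "strict_mono_on S g" and h: "strict_mono_on T h" and gh: "g ` S \<inter> h ` T = {}"
    and C1: "C1 \<subseteq> S" "finite C1" and C2: "C2 \<subseteq> T" "finite C2"
    and k: "strict_mono_on (g ` C1 \<union> h ` C2) k"
      "k ` (g ` C1 \<union> h ` C2) = {1..card (g ` C1 \<union> h ` C2)}"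
  shows "restr (relabel g P @ relabel h Q) (g ` C1 \<union> h ` C2) =
    is_map {1..card C1} (k ` g ` C1) (restr P C1) @ is_map {1..card C2} (k ` h ` C2) (restr Q C2)"
proof -
  let ?C = "g ` C1 \<union> h ` C2"
  have "g ` S \<inter> ?C = g ` S \<inter> g ` C1" "h ` T \<inter> ?C = h ` T \<inter> h ` C2"
    using gh C1 C2 by blast+
  then have tr: "trace (relabel g P) ?C = trace (relabel g P) (g ` C1)"
    "trace (relabel h Q) ?C = trace (relabel h Q) (h ` C2)"
    using P Q by (intro trace_cong; simp only: Union_relabel is_setcomp_Union)+
  have g1: "trace (relabel g P) (g ` C1) = relabel g (trace P C1)"
    using strict_mono_on_imp_inj_on[OF g] P C1 by (intro trace_relabel) (auto simp: is_setcomp_Union)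
  have h1: "trace (relabel h Q) (h ` C2) = relabel h (trace Q C2)"
    using strict_mono_on_imp_inj_on[OF h] Q C2 by (intro trace_relabel) (auto simp: is_setcomp_Union)
  have "restr (relabel g P @ relabel h Q) ?C =
      relabel k (trace (relabel g P @ relabel h Q) ?C)"
    using k C1 C2 by (intro restr_relabel_trace) auto
  also have "\<dots> = relabel (\<lambda>x. k (g x)) (trace P C1) @ relabel (\<lambda>x. k (h x)) (trace Q C2)"
    by (simp only: trace_append tr g1 h1 map_append relabel_relabel)
  also have "relabel (\<lambda>x. k (g x)) (trace P C1) = is_map {1..card C1} ((\<lambda>x. k (g x)) ` C1) (restr P C1)"
    by (rule is_map_restr[symmetric, OF C1(2) strict_mono_on_comp[OF monotone_on_subset[OF g C1(1)]
            monotone_on_subset[OF k(1) Un_upper1]]])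
  also have "relabel (\<lambda>x. k (h x)) (trace Q C2) = is_map {1..card C2} ((\<lambda>x. k (h x)) ` C2) (restr Q C2)"
    by (rule is_map_restr[symmetric, OF C2(2) strict_mono_on_comp[OF monotone_on_subset[OF h C2(1)]
            monotone_on_subset[OF k(1) Un_upper2]]])
  finally show ?thesis by (simp add: image_image)
qed

section \<open>Concatenation product and unshuffling coproduct\<close>

definition shifted_append :: "scomp \<Rightarrow> scomp \<Rightarrow> scomp" where
  "shifted_append P Q = P @ relabel ((+) (cdeg P)) Q"

lemma bar_mult_shifted_append: "bar_mult P Q = frag_of (shifted_append P Q)"
  by (simp add: bar_mult_def shifted_append_def)

lemma strict_mono_on_plus: "strict_mono_on S ((+) (n::nat))"
  by (auto simp: strict_mono_on_def)

lemma image_plus_initial: "(+) p ` {1..q} = {p + 1..p + q}" for p q :: nat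
  by (simp add: add.commute)

lemma is_setcomp_shifted_append:
  assumes "P \<in> Comps" "Q \<in> Comps"
  shows "is_setcomp {1..cdeg P + cdeg Q} (shifted_append P Q)"
proof -
  have "is_setcomp {cdeg P + 1..cdeg P + cdeg Q} (relabel ((+) (cdeg P)) Q)"
    using is_setcomp_relabel[OF CompsD[OF assms(2)], of "(+) (cdeg P)"]
    by (simp only: image_plus_initial) simp
  then show ?thesis
    unfolding shifted_append_def is_setcomp_append using CompsD[OF assms(1)]
    by (intro exI[of _ "{1..cdeg P}"] exI[of _ "{cdeg P + 1..cdeg P + cdeg Q}"]) auto
qed

lemma shifted_append_Comps:
  assumes "P \<in> Comps" "Q \<in> Comps"
  shows "shifted_append P Q \<in> Comps" "cdeg (shifted_append P Q) = cdeg P + cdeg Q"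
  using CompsI is_setcomp_cdeg is_setcomp_shifted_append[OF assms] by blast+

lemma shifted_append_assoc:
  assumes "P \<in> Comps" "Q \<in> Comps"
  shows "shifted_append (shifted_append P Q) S = shifted_append P (shifted_append Q S)"
proof -
  have "cdeg (shifted_append P Q) = cdeg P + cdeg Q" using assms by (rule shifted_append_Comps)
  then show ?thesis by (simp add: shifted_append_def image_image add.assoc)
qed

lemma restr_shifted_append:
  assumes P: "P \<in> Comps" and Q: "Q \<in> Comps"
    and C1: "C1 \<subseteq> {1..cdeg P}" and C2: "C2 \<subseteq> {1..cdeg Q}"
  shows "restr (shifted_append P Q) (C1 \<union> (+) (cdeg P) ` C2) =
    shifted_append (restr P C1) (restr Q C2)"
proof -
  let ?p = "cdeg P"
  have fin: "finite C1" "finite C2" using C1 C2 finite_subset by blast+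
  \<comment> \<open>The two pieces lie in order, so standardizing their union standardizes each
    piece and moves the second one up by the size of the first.\<close>
  define k where "k = (\<lambda>x. if x \<le> ?p then stdz C1 x else card C1 + stdz C2 (x - ?p))"
  have k1: "k x = stdz C1 x" "k x \<in> {1..card C1}" if "x \<in> C1" for x
    using that C1 stdz_image[OF fin(1)] by (auto simp: k_def)
  have k2: "k (?p + x) = card C1 + stdz C2 x" "k (?p + x) > card C1" if "x \<in> C2" for x
    using that C2 stdz_image[OF fin(2)] by (force simp: k_def)+
  have kC1: "k ` C1 = {1..card C1}"
    using k1 stdz_image[OF fin(1)] by (metis (no_types, lifting) image_cong)
  have kC2: "k ` (+) ?p ` C2 = (+) (card C1) ` {1..card C2}"
  proof -
    have "k ` (+) ?p ` C2 = (\<lambda>x. card C1 + stdz C2 x) ` C2"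
      unfolding image_image using k2 by (intro image_cong) auto
    also have "\<dots> = (+) (card C1) ` (stdz C2 ` C2)" by (simp add: image_image)
    finally show ?thesis by (simp only: stdz_image[OF fin(2)])
  qed
  have sm: "strict_mono_on (C1 \<union> (+) ?p ` C2) k"
  proof (rule strict_mono_onI)
    fix x y assume xy: "x \<in> C1 \<union> (+) ?p ` C2" "y \<in> C1 \<union> (+) ?p ` C2" "x < y"
    consider "x \<in> C1" "y \<in> C1" | "x \<in> C1" "y \<in> (+) ?p ` C2" | "x \<in> (+) ?p ` C2" "y \<in> (+) ?p ` C2"
      | "x \<in> (+) ?p ` C2" "y \<in> C1" using xy by blast
    then show "k x < k y"
    proof cases
      case 1
      then show ?thesis using xy(3) k1(1) strict_mono_onD[OF stdz_strict_mono[OF fin(1)]] by simp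
    next
      case 2
      then show ?thesis using k1(2) k2(2) by force
    next
      case 3
      then obtain u v where "x = ?p + u" "u \<in> C2" "y = ?p + v" "v \<in> C2" by blast
      then show ?thesis using xy(3) k2(1) strict_mono_onD[OF stdz_strict_mono[OF fin(2)], of u v] by simp
    next
      case 4
      then show ?thesis using xy(3) C1 C2 by fastforce
    qed
  qed
  have disj: "(\<lambda>x. x) ` {1..?p} \<inter> (+) ?p ` {1..cdeg Q} = {}" by auto
  have "C1 \<inter> (+) ?p ` C2 = {}" using disj C1 C2 by blast
  then have "card (C1 \<union> (+) ?p ` C2) = card C1 + card C2"
    using fin by (simp add: card_Un_disjoint card_image)
  then have im: "k ` (C1 \<union> (+) ?p ` C2) = {1..card (C1 \<union> (+) ?p ` C2)}"
    unfolding image_Un kC1 kC2 image_plus_initial by auto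
  have "restr (shifted_append P Q) (C1 \<union> (+) ?p ` C2) =
      is_map {1..card C1} (k ` C1) (restr P C1) @
      is_map {1..card C2} (k ` (+) ?p ` C2) (restr Q C2)"
    using restr_append_relabel[OF CompsD[OF P] CompsD[OF Q] strict_mono_on_id strict_mono_on_plus disj
        C1 fin(1) C2 fin(2), of k] sm im
    by (simp add: shifted_append_def relabel_id)
  also have "is_map {1..card C1} (k ` C1) (restr P C1) = restr P C1"
    unfolding kC1 using is_setcomp_restr[OF CompsD[OF P] C1 fin(1)] by (intro is_map_id) auto
  also have "is_map {1..card C2} (k ` (+) ?p ` C2) (restr Q C2) = relabel ((+) (card C1)) (restr Q C2)"
    unfolding kC2 using is_setcomp_restr[OF CompsD[OF Q] C2 fin(2)]
    by (intro is_map_relabel strict_mono_on_plus) (auto simp: is_setcomp_Union)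
  finally show ?thesis
    by (simp add: shifted_append_def restr_Comps(2)[OF P C1])
qed

text \<open>A subset of the joint ground set amounts to its part in \<open>{1..?p}\<close> together
  with the remaining part shifted down by \<open>?p\<close>. Taking complements respects this
  decomposition, so both tensor factors split simultaneously.\<close>

lemma bar_mult_hat_delta:
  assumes P: "P \<in> Comps" and Q: "Q \<in> Comps"
  shows "frag_extend hat_delta (bar_mult P Q) = tensor_mult bar_mult (hat_delta P) (hat_delta Q)"
proof -
  let ?p = "cdeg P" and ?q = "cdeg Q"
  let ?n = "?p + ?q" and ?R = "shifted_append P Q"
  let ?f = "\<lambda>C. frag_of (restr ?R C, restr ?R ({1..?n} - C))"
  let ?j = "\<lambda>(C1, C2). C1 \<union> (+) ?p ` C2"
  have "frag_extend hat_delta (bar_mult P Q) = (\<Sum>C\<in>Pow {1..?n}. ?f C)"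
    by (simp add: bar_mult_shifted_append hat_delta_def shifted_append_Comps[OF P Q])
  also have "\<dots> = (\<Sum>(C1, C2)\<in>Pow {1..?p} \<times> Pow {1..?q}. frag_of
      (shifted_append (restr P C1) (restr Q C2),
        shifted_append (restr P ({1..?p} - C1)) (restr Q ({1..?q} - C2))))"
  proof (rule sum.reindex_bij_witness[where i = ?j and
        j = "\<lambda>C. (C \<inter> {1..?p}, (\<lambda>x. x - ?p) ` (C - {1..?p}))"])
    fix C assume "C \<in> Pow {1..?n}"
    then have C: "C \<subseteq> {1..?n}" by simp
    \<comment> \<open>Truncated subtraction is undone here because \<open>C\<close> does not contain
      0, so all elements outside \<open>{1..?p}\<close> exceed \<open>?p\<close>.\<close>
    have shift: "(+) ?p ` (\<lambda>x. x - ?p) ` (C - {1..?p}) = C - {1..?p}"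
      unfolding image_image using C by (force simp: image_iff)
    then show inv: "?j (C \<inter> {1..?p}, (\<lambda>x. x - ?p) ` (C - {1..?p})) = C" by auto
    let ?C1 = "C \<inter> {1..?p}" and ?C2 = "(\<lambda>x. x - ?p) ` (C - {1..?p})"
    have sub: "?C1 \<subseteq> {1..?p}" "?C2 \<subseteq> {1..?q}" using C by force+
    then show "(?C1, ?C2) \<in> Pow {1..?p} \<times> Pow {1..?q}" by simp
    have "(+) ?p ` ({1..?q} - ?C2) = {?p + 1..?n} - (C - {1..?p})"
      by (simp only: image_set_diff[OF inj_on_add] shift image_plus_initial)
    then have compl: "?j ({1..?p} - ?C1, {1..?q} - ?C2) = {1..?n} - C" by auto
    show "(case (?C1, ?C2) of (C1, C2) \<Rightarrow> frag_of
      (shifted_append (restr P C1) (restr Q C2),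
        shifted_append (restr P ({1..?p} - C1)) (restr Q ({1..?q} - C2)))) = ?f C"
      using restr_shifted_append[OF P Q sub]
        restr_shifted_append[OF P Q Diff_subset Diff_subset, of ?C1 ?C2] inv compl
      by simp
  next
    fix x assume "x \<in> Pow {1..?p} \<times> Pow {1..?q}"
    then obtain C1 C2 where x: "x = (C1, C2)" "C1 \<subseteq> {1..?p}" "C2 \<subseteq> {1..?q}" by blast
    then show "?j x \<in> Pow {1..?n}" by auto
    have "?j x \<inter> {1..?p} = C1" using x by auto
    moreover have "?j x - {1..?p} = (+) ?p ` C2" using x by auto
    ultimately show "(?j x \<inter> {1..?p}, (\<lambda>x. x - ?p) ` (?j x - {1..?p})) = x"
      using x(1) by (simp add: image_image)
  qed
  also have "\<dots> = tensor_mult bar_mult (hat_delta P) (hat_delta Q)"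
    by (simp add: hat_delta_def tensor_mult_sum_of bar_mult_shifted_append sum.cartesian_product)
  finally show ?thesis .
qed

section \<open>Shuffle product and deconcatenation of positions\<close>

abbreviation msubsets :: "nat \<Rightarrow> nat \<Rightarrow> nat set set" where
  "msubsets p q \<equiv> {A. A \<subseteq> {1..p + q} \<and> card A = p}"

text \<open>The positions that an increasing map sends to values up to \<open>r\<close> form a lower
  set, hence an initial segment, and its length is found by counting the values.\<close>

lemma strict_mono_on_image_initial:
  fixes g :: "nat \<Rightarrow> nat"
  assumes g: "strict_mono_on {1..p} g" and A: "g ` {1..p} = A" "A \<subseteq> {1..n}"
  shows "g ` {1..card (A \<inter> {1..r})} = A \<inter> {1..r}"
    and "g ` {card (A \<inter> {1..r}) + 1..p} = A - {1..r}"
    and "card (A \<inter> {1..r}) \<le> p"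
proof -
  let ?B = "{x \<in> {1..p}. g x \<le> r}"
  have "1 \<le> g x" if "x \<in> {1..p}" for x using A that by (metis atLeastAtMost_iff imageI subsetD)
  then have gB: "g ` ?B = A \<inter> {1..r}" using A(1) by auto
  have "g y \<le> r" if "x \<in> ?B" "y \<in> {1..p}" "y < x" for x y
    using strict_mono_onD[OF g, of y x] that by auto
  then have "?B \<in> lower_sets {1..p}" by (auto simp: lower_sets_def)
  then obtain m where "?B = {1..m}" "m \<in> {0..p}" unfolding lower_sets_initial by blast
  then have m: "?B = {1..m}" "m \<le> p" by simp_all
  have inj: "inj_on g {1..p}" using g by (rule strict_mono_on_imp_inj_on)
  have "card (A \<inter> {1..r}) = card ?B"
    using gB inj by (metis (no_types, lifting) card_image inj_on_subset mem_Collect_eq subsetI)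
  then have card: "card (A \<inter> {1..r}) = m" using m by simp
  then show "g ` {1..card (A \<inter> {1..r})} = A \<inter> {1..r}" "card (A \<inter> {1..r}) \<le> p"
    using gB m by simp_all
  have "{m + 1..p} = {1..p} - {1..m}" by auto
  then have "g ` {m + 1..p} = A - (A \<inter> {1..r})"
    using inj_on_image_set_diff[OF inj, of "{1..p}" "{1..m}"] A(1) gB m by auto
  then show "g ` {card (A \<inter> {1..r}) + 1..p} = A - {1..r}" using card by auto
qed

text \<open>Of the first \<open>r\<close> positions, \<open>p1\<close> belong to \<open>A\<close>
  and the other \<open>q1\<close> to its complement. As the factors are placed increasingly, the cut
  at \<open>r\<close> cuts them after \<open>p1\<close> and \<open>q1\<close>, and both sides are
  again shuffles.\<close>

lemma restr_shuffle:
  assumes P: "P \<in> Comps" and Q: "Q \<in> Comps" and A: "A \<in> msubsets (cdeg P) (cdeg Q)"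
    and r: "r \<le> cdeg P + cdeg Q"
  defines "p1 \<equiv> card (A \<inter> {1..r})"
  defines "q1 \<equiv> r - p1"
  shows "p1 \<le> cdeg P" "q1 \<le> cdeg Q" "p1 \<le> r"
    and "restr (shuffle P Q A) {1..r} = shuffle (restr P {1..p1}) (restr Q {1..q1}) (A \<inter> {1..r})"
    and "restr (shuffle P Q A) {r + 1..cdeg P + cdeg Q} =
      shuffle (restr P {p1 + 1..cdeg P}) (restr Q {q1 + 1..cdeg Q}) ((\<lambda>x. x - r) ` (A - {1..r}))"
proof -
  let ?p = "cdeg P" and ?q = "cdeg Q"
  let ?n = "?p + ?q"
  let ?B = "{1..?n} - A"
  let ?g = "ord_iso {1..?p} A" and ?h = "ord_iso {1..?q} ?B"
  have fin: "finite A" using A finite_subset by blast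
  have AB: "A \<subseteq> {1..?n}" "?B \<subseteq> {1..?n}" "card A = ?p" "card ?B = ?q"
    using A card_compl_shuffle by auto
  have g: "strict_mono_on {1..?p} ?g" "?g ` {1..?p} = A"
    using ord_iso_strict_mono_image[of "{1..?p}" A] fin AB by simp_all
  have h: "strict_mono_on {1..?q} ?h" "?h ` {1..?q} = ?B"
    using ord_iso_strict_mono_image[of "{1..?q}" ?B] AB by simp_all
  have gh: "?g ` {1..?p} \<inter> ?h ` {1..?q} = {}" unfolding g h by blast
  have sh: "shuffle P Q A = relabel ?g P @ relabel ?h Q"
    by (simp add: shuffle_def is_map_ord_iso)
  have Br: "?B \<inter> {1..r} = {1..r} - (A \<inter> {1..r})" using r by auto
  \<comment> \<open>Rewriting the difference as a count in the complement lets the fact used for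
    \<open>p1\<close> apply to the second factor as well.\<close>
  have q1: "q1 = card (?B \<inter> {1..r})"
    unfolding Br q1_def p1_def by (subst card_Diff_subset) (auto simp: fin)
  note g1 = strict_mono_on_image_initial[OF g AB(1), of r, folded p1_def]
  note h1 = strict_mono_on_image_initial[OF h AB(2), of r, folded q1]
  show p1p: "p1 \<le> ?p" and q1q: "q1 \<le> ?q" using g1 h1 by auto
  have "p1 \<le> card {1..r}" unfolding p1_def by (rule card_mono) auto
  then show p1r: "p1 \<le> r" by simp
  have un: "A \<inter> {1..r} \<union> ?B \<inter> {1..r} = {1..r}" using r by auto
  have c1: "cdeg (restr P {1..p1}) = p1" "cdeg (restr Q {1..q1}) = q1"
    using restr_Comps(2)[OF P, of "{1..p1}"] restr_Comps(2)[OF Q, of "{1..q1}"] p1p q1q by auto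
  have c2: "cdeg (restr P {p1 + 1..?p}) = ?p - p1" "cdeg (restr Q {q1 + 1..?q}) = ?q - q1"
    using restr_Comps(2)[OF P, of "{p1 + 1..?p}"] restr_Comps(2)[OF Q, of "{q1 + 1..?q}"] by auto
  have "restr (shuffle P Q A) {1..r} =
      is_map {1..card {1..p1}} (A \<inter> {1..r}) (restr P {1..p1}) @
      is_map {1..card {1..q1}} (?B \<inter> {1..r}) (restr Q {1..q1})"
    using restr_append_relabel[OF CompsD[OF P] CompsD[OF Q] g(1) h(1) gh,
        of "{1..p1}" "{1..q1}" "\<lambda>x. x"] p1p q1q
    unfolding g1(1) h1(1) un sh by (simp add: strict_mono_on_id)
  also have "\<dots> = shuffle (restr P {1..p1}) (restr Q {1..q1}) (A \<inter> {1..r})"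
    unfolding shuffle_def c1 Br using p1r by (simp add: q1_def)
  finally show "restr (shuffle P Q A) {1..r} =
      shuffle (restr P {1..p1}) (restr Q {1..q1}) (A \<inter> {1..r})" .
  \<comment> \<open>Above \<open>r\<close> truncated subtraction is strictly monotone, so it
    standardizes the final segment.\<close>
  let ?k = "\<lambda>x. x - r"
  have un2: "(A - {1..r}) \<union> (?B - {1..r}) = {r + 1..?n}" using AB by auto
  have k: "strict_mono_on {r + 1..?n} ?k" by (auto simp: strict_mono_on_def)
  have kim: "?k ` {r + 1..?n} = {1..?n - r}"
    using r by (auto simp: image_iff intro!: bexI[of _ "_ + r"])
  have kB: "?k ` (?B - {1..r}) = {1..?n - r} - ?k ` (A - {1..r})"
  proof -
    have "?B - {1..r} = {r + 1..?n} - (A - {1..r})" using AB by auto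
    then show ?thesis
      using inj_on_image_set_diff[OF strict_mono_on_imp_inj_on[OF k], of "{r + 1..?n}" "A - {1..r}"] un2 kim
      by auto
  qed
  have "restr (shuffle P Q A) {r + 1..?n} =
      is_map {1..card {p1 + 1..?p}} (?k ` (A - {1..r})) (restr P {p1 + 1..?p}) @
      is_map {1..card {q1 + 1..?q}} (?k ` (?B - {1..r})) (restr Q {q1 + 1..?q})"
    using restr_append_relabel[OF CompsD[OF P] CompsD[OF Q] g(1) h(1) gh,
        of "{p1 + 1..?p}" "{q1 + 1..?q}" ?k] k kim
    unfolding g1(2) h1(2) un2 sh by simp
  also have "\<dots> = shuffle (restr P {p1 + 1..?p}) (restr Q {q1 + 1..?q}) (?k ` (A - {1..r}))"
  proof -
    have "?n - r = ?p - p1 + (?q - q1)" using p1p q1q p1r q1_def by simp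
    then show ?thesis unfolding shuffle_def c2 kB by simp
  qed
  finally show "restr (shuffle P Q A) {r + 1..?n} =
      shuffle (restr P {p1 + 1..?p}) (restr Q {q1 + 1..?q}) (?k ` (A - {1..r}))" .
qed

text \<open>Read \<open>A\<close> as a lattice path with \<open>?p\<close> steps of one kind and
  \<open>?q\<close> of the other. A path with a marked point \<open>r\<close> is the same as a point
  \<open>(p1, q1)\<close> with one path leading to it and one leaving it. Going back,
  \<open>r = p1 + q1\<close>, and \<open>A\<close> consists of \<open>A1\<close> and the shift of
  \<open>A2\<close> by \<open>r\<close>.\<close>

lemma hat_mult_bar_delta:
  assumes P: "P \<in> Comps" and Q: "Q \<in> Comps"
  shows "frag_extend bar_delta (hat_mult P Q) = tensor_mult hat_mult (bar_delta P) (bar_delta Q)"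
proof -
  let ?p = "cdeg P" and ?q = "cdeg Q"
  let ?n = "?p + ?q"
  let ?X = "\<lambda>p1 q1. msubsets p1 q1 \<times> msubsets (?p - p1) (?q - q1)"
  let ?F = "\<lambda>p1 q1 A1 A2. frag_of
    (shuffle (restr P {1..p1}) (restr Q {1..q1}) A1,
     shuffle (restr P {p1 + 1..?p}) (restr Q {q1 + 1..?q}) A2)"
  have "frag_extend bar_delta (hat_mult P Q) = (\<Sum>A\<in>msubsets ?p ?q. bar_delta (shuffle P Q A))"
    by (simp add: hat_mult_shuffle frag_extend_sum_of)
  also have "\<dots> = (\<Sum>A\<in>msubsets ?p ?q. \<Sum>r\<in>{0..?n}.
      frag_of (restr (shuffle P Q A) {1..r}, restr (shuffle P Q A) {r + 1..?n}))"
    using shuffle_Comp(3)[OF P Q] by (intro sum.cong refl) (simp add: bar_delta_def Comp_iff)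
  also have "\<dots> = (\<Sum>(A, r)\<in>msubsets ?p ?q \<times> {0..?n}.
      frag_of (restr (shuffle P Q A) {1..r}, restr (shuffle P Q A) {r + 1..?n}))"
    by (simp only: sum.cartesian_product)
  also have "\<dots> = (\<Sum>(p1, q1, A1, A2)\<in>(SIGMA p1:{0..?p}. SIGMA q1:{0..?q}. ?X p1 q1). ?F p1 q1 A1 A2)"
  proof (rule sum.reindex_bij_witness[where
        i = "\<lambda>(p1, q1, A1, A2). (A1 \<union> (+) (p1 + q1) ` A2, p1 + q1)" and
        j = "\<lambda>(A, r). (card (A \<inter> {1..r}), r - card (A \<inter> {1..r}), A \<inter> {1..r}, (\<lambda>x. x - r) ` (A - {1..r}))"])
    fix x assume "x \<in> msubsets ?p ?q \<times> {0..?n}"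
    then obtain A r where x: "x = (A, r)" and A: "A \<in> msubsets ?p ?q" and r: "r \<le> ?n" by auto
    let ?p1 = "card (A \<inter> {1..r})"
    let ?q1 = "r - ?p1"
    let ?A2 = "(\<lambda>x. x - r) ` (A - {1..r})"
    note S = restr_shuffle[OF P Q A r]
    have fin: "finite A" using A finite_subset by blast
    have pq: "?p1 + ?q1 = r" using S by simp
    have shift: "(+) r ` ?A2 = A - {1..r}"
      unfolding image_image using A by (force simp: image_iff)
    show "(case case x of (A, r) \<Rightarrow> (card (A \<inter> {1..r}), r - card (A \<inter> {1..r}), A \<inter> {1..r},
        (\<lambda>x. x - r) ` (A - {1..r})) of (p1, q1, A1, A2) \<Rightarrow> (A1 \<union> (+) (p1 + q1) ` A2, p1 + q1)) = x"
      unfolding x prod.case pq shift by auto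
    have "?A2 \<subseteq> {1..?n - r}" using A by force
    moreover have "?n - r = ?p - ?p1 + (?q - ?q1)" using S by simp
    moreover have "card ?A2 = ?p - ?p1"
    proof -
      have "card ?A2 = card (A - {1..r})" using shift by (metis card_image inj_on_add)
      also have "\<dots> = card (A - (A \<inter> {1..r}))" by (simp add: Diff_Int)
      also have "\<dots> = card A - ?p1" using fin by (subst card_Diff_subset) auto
      finally show ?thesis using A by simp
    qed
    ultimately have "(A \<inter> {1..r}, ?A2) \<in> ?X ?p1 ?q1" unfolding pq by auto
    then show "(case x of (A, r) \<Rightarrow> (card (A \<inter> {1..r}), r - card (A \<inter> {1..r}), A \<inter> {1..r},
        (\<lambda>x. x - r) ` (A - {1..r}))) \<in> (SIGMA p1:{0..?p}. SIGMA q1:{0..?q}. ?X p1 q1)"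
      unfolding x prod.case using S(1,2) by (intro SigmaI) auto
    show "(case case x of (A, r) \<Rightarrow> (card (A \<inter> {1..r}), r - card (A \<inter> {1..r}), A \<inter> {1..r},
        (\<lambda>x. x - r) ` (A - {1..r})) of (p1, q1, A1, A2) \<Rightarrow> ?F p1 q1 A1 A2) =
      (case x of (A, r) \<Rightarrow>
        frag_of (restr (shuffle P Q A) {1..r}, restr (shuffle P Q A) {r + 1..?n}))"
      unfolding x prod.case S(4,5) ..
  next
    fix y assume "y \<in> (SIGMA p1:{0..?p}. SIGMA q1:{0..?q}. ?X p1 q1)"
    then obtain p1 q1 A1 A2 where y: "y = (p1, q1, A1, A2)" and p1: "p1 \<le> ?p" and q1: "q1 \<le> ?q"
      and A1: "A1 \<subseteq> {1..p1 + q1}" "card A1 = p1"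
      and A2: "A2 \<subseteq> {1..?p - p1 + (?q - q1)}" "card A2 = ?p - p1"
      by auto
    let ?r = "p1 + q1"
    let ?A = "A1 \<union> (+) ?r ` A2"
    have A1r: "?A \<inter> {1..?r} = A1" using A1 A2 by auto
    have A2r: "?A - {1..?r} = (+) ?r ` A2" using A1 A2 by auto
    show "(case case y of (p1, q1, A1, A2) \<Rightarrow> (A1 \<union> (+) (p1 + q1) ` A2, p1 + q1) of
      (A, r) \<Rightarrow> (card (A \<inter> {1..r}), r - card (A \<inter> {1..r}), A \<inter> {1..r},
        (\<lambda>x. x - r) ` (A - {1..r}))) = y"
      unfolding y prod.case A1r A2r by (simp add: A1 image_image)
    have "finite A1" "finite A2" using A1 A2 finite_subset by blast+
    moreover have "{1..?r} \<inter> (+) ?r ` {1..?p - p1 + (?q - q1)} = {}" by auto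
    then have "A1 \<inter> (+) ?r ` A2 = {}" using A1(1) A2(1) by blast
    ultimately have "card ?A = ?p" using A1 A2 p1 by (simp add: card_Un_disjoint card_image)
    moreover have "?A \<subseteq> {1..?n}" using A1 A2 p1 q1 by force
    ultimately show "(case y of (p1, q1, A1, A2) \<Rightarrow> (A1 \<union> (+) (p1 + q1) ` A2, p1 + q1))
        \<in> msubsets ?p ?q \<times> {0..?n}"
      unfolding y prod.case using p1 q1 by auto
  qed
  also have "\<dots> = (\<Sum>p1\<in>{0..?p}. \<Sum>(q1, A1, A2)\<in>(SIGMA q1:{0..?q}. ?X p1 q1). ?F p1 q1 A1 A2)"
    by (rule sum.Sigma[symmetric]) auto
  also have "\<dots> = (\<Sum>p1\<in>{0..?p}. \<Sum>q1\<in>{0..?q}. \<Sum>(A1, A2)\<in>?X p1 q1. ?F p1 q1 A1 A2)"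
    by (intro sum.cong refl sum.Sigma[symmetric]) auto
  also have "\<dots> = (\<Sum>p1\<in>{0..?p}. \<Sum>q1\<in>{0..?q}. \<Sum>A1\<in>msubsets p1 q1.
      \<Sum>A2\<in>msubsets (?p - p1) (?q - q1). ?F p1 q1 A1 A2)"
    by (simp only: sum.cartesian_product)
  also have "\<dots> = (\<Sum>p1\<in>{0..?p}. \<Sum>q1\<in>{0..?q}.
      tens (hat_mult (restr P {1..p1}) (restr Q {1..q1}))
        (hat_mult (restr P {p1 + 1..?p}) (restr Q {q1 + 1..?q})))"
  proof (intro sum.cong refl)
    fix p1 q1 assume "p1 \<in> {0..?p}" "q1 \<in> {0..?q}"
    then have "cdeg (restr P {1..p1}) = p1" "cdeg (restr Q {1..q1}) = q1"
      "cdeg (restr P {p1 + 1..?p}) = ?p - p1" "cdeg (restr Q {q1 + 1..?q}) = ?q - q1"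
      using restr_Comps(2)[OF P, of "{1..p1}"] restr_Comps(2)[OF Q, of "{1..q1}"]
        restr_Comps(2)[OF P, of "{p1 + 1..?p}"] restr_Comps(2)[OF Q, of "{q1 + 1..?q}"] by auto
    then show "(\<Sum>A1\<in>msubsets p1 q1. \<Sum>A2\<in>msubsets (?p - p1) (?q - q1). ?F p1 q1 A1 A2) =
      tens (hat_mult (restr P {1..p1}) (restr Q {1..q1}))
        (hat_mult (restr P {p1 + 1..?p}) (restr Q {q1 + 1..?q}))"
      by (simp add: hat_mult_shuffle tens_sum_of)
  qed
  also have "\<dots> = tensor_mult hat_mult (bar_delta P) (bar_delta Q)"
    by (simp add: bar_delta_def tensor_mult_sum_of)
  finally show ?thesis .
qed

section \<open>The two bialgebras on set compositions\<close>

lemma t_eps_Nil [simp]: "t_eps [] = 1"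
  by (simp add: t_eps_def)

lemma bialgebra_bar_hat:
  "graded_connected_bialgebra Comps [] bar_mult hat_delta t_eps cdeg"
proof
  fix P Q S assume P: "P \<in> Comps" and Q: "Q \<in> Comps" and S: "S \<in> Comps"
  show "mult_ext bar_mult (bar_mult P Q) (frag_of S) = mult_ext bar_mult (frag_of P) (bar_mult Q S)"
    by (simp add: bar_mult_shifted_append shifted_append_assoc[OF P Q])
next
  fix P Q assume P: "P \<in> Comps" and Q: "Q \<in> Comps"
  show "Poly_Mapping.keys (bar_mult P Q) \<subseteq> Comps"
    by (simp add: bar_mult_shifted_append shifted_append_Comps[OF P Q])
  show "frag_extend hat_delta (bar_mult P Q) = tensor_mult bar_mult (hat_delta P) (hat_delta Q)"
    by (rule bar_mult_hat_delta[OF P Q])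
  show "counit_ext t_eps (bar_mult P Q) = t_eps P * t_eps Q"
    by (simp add: bar_mult_shifted_append t_eps_def shifted_append_def)
  fix R assume "R \<in> Poly_Mapping.keys (bar_mult P Q)"
  then show "cdeg R = cdeg P + cdeg Q"
    by (simp add: bar_mult_shifted_append shifted_append_Comps[OF P Q])
next
  fix P assume P: "P \<in> Comps"
  show "bar_mult [] P = frag_of P" "bar_mult P [] = frag_of P"
    by (simp_all add: bar_mult_shifted_append shifted_append_def relabel_id)
  show "t_eps P = 0" if "cdeg P \<noteq> 0"
    using that by (auto simp: t_eps_def)
next
  show "{P \<in> Comps. cdeg P = 0} = {[]}" using cdeg_0 by auto
qed (simp_all add: hat_delta_split all_splits.split_delta_mem all_splits.split_delta_deg
    all_splits.split_delta_Nil all_splits.split_delta_counit all_splits.split_delta_coassoc)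

lemma bialgebra_hat_bar:
  "graded_connected_bialgebra Comps [] hat_mult bar_delta t_eps cdeg"
proof
  fix P Q S assume P: "P \<in> Comps" and Q: "Q \<in> Comps" and S: "S \<in> Comps"
  show "mult_ext hat_mult (hat_mult P Q) (frag_of S) = mult_ext hat_mult (frag_of P) (hat_mult Q S)"
    by (rule hat_mult_assoc[OF P Q S])
next
  fix P Q assume P: "P \<in> Comps" and Q: "Q \<in> Comps"
  show "Poly_Mapping.keys (hat_mult P Q) \<subseteq> Comps"
    using hat_mult_keys[OF P Q] glued_Comps(1) by blast
  show "frag_extend bar_delta (hat_mult P Q) = tensor_mult hat_mult (bar_delta P) (bar_delta Q)"
    by (rule hat_mult_bar_delta[OF P Q])
  show "counit_ext t_eps (hat_mult P Q) = t_eps P * t_eps Q"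
    by (rule hat_mult_counit[OF P Q])
  fix R assume "R \<in> Poly_Mapping.keys (hat_mult P Q)"
  then show "cdeg R = cdeg P + cdeg Q"
    using hat_mult_keys[OF P Q] glued_Comps(2) by blast
next
  fix P assume P: "P \<in> Comps"
  show "hat_mult [] P = frag_of P" "hat_mult P [] = frag_of P"
    by (rule hat_mult_Nil[OF P])+
  show "t_eps P = 0" if "cdeg P \<noteq> 0"
    using that by (auto simp: t_eps_def)
next
  show "{P \<in> Comps. cdeg P = 0} = {[]}" using cdeg_0 by auto
qed (simp_all add: bar_delta_split lower_splits.split_delta_mem lower_splits.split_delta_deg
    lower_splits.split_delta_Nil lower_splits.split_delta_counit lower_splits.split_delta_coassoc)

text \<open>Complementation permutes the subsets of the ground set and exchanges the two tensor
  factors.\<close>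

lemma cocommutative_hat_delta: "cocommutative Comps hat_delta"
  unfolding cocommutative_def
proof
  fix P assume "P \<in> Comps"
  let ?S = "{1..cdeg P}"
  have "frag_extend (\<lambda>(b, c). frag_of (c, b)) (hat_delta P) =
      (\<Sum>A\<in>Pow ?S. frag_of (restr P (?S - A), restr P A))"
    by (simp add: hat_delta_def frag_extend_sum_of)
  also have "\<dots> = hat_delta P"
    unfolding hat_delta_def
    by (rule sum.reindex_bij_witness[where i = "\<lambda>A. ?S - A" and j = "\<lambda>A. ?S - A"])
      (auto simp: double_diff)
  finally show "frag_extend (\<lambda>(b, c). frag_of (c, b)) (hat_delta P) = hat_delta P" .
qed

subsection \<open>Quasi-symmetric functions in non-commuting variables\<close>

text \<open>Positions grouped by letter, in increasing order of the letters. Positions count from 1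
  while list indices count from 0, hence \<open>j - 1\<close>.\<close>

definition comp_of :: "nat list \<Rightarrow> scomp" where
  "comp_of w = map (\<lambda>v. {j \<in> {1..length w}. w ! (j - 1) = v}) (sorted_list_of_set (set w))"

lemma positions_image: "(\<lambda>j. w ! (j - 1)) ` {1..length w} = set w"
proof (intro equalityI subsetI)
  fix v assume "v \<in> set w"
  then obtain i where "i < length w" "w ! i = v" by (metis in_set_conv_nth)
  then show "v \<in> (\<lambda>j. w ! (j - 1)) ` {1..length w}"
    by (intro image_eqI[of _ _ "Suc i"]) auto
next
  fix v assume "v \<in> (\<lambda>j. w ! (j - 1)) ` {1..length w}"
  then obtain j where "1 \<le> j" "j \<le> length w" "v = w ! (j - 1)" by auto
  then show "v \<in> set w" by simp
qed

lemma mem_set_positions: "v \<in> set w \<longleftrightarrow> {j \<in> {1..length w}. w ! (j - 1) = v} \<noteq> {}"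
  unfolding positions_image[symmetric] by (simp only: image_iff) blast

lemma is_setcomp_comp_of: "is_setcomp {1..length w} (comp_of w)"
  unfolding is_setcomp_iff
proof (intro conjI)
  show "{} \<notin> set (comp_of w)"
  proof
    assume "{} \<in> set (comp_of w)"
    then obtain v where "v \<in> set w" "{j \<in> {1..length w}. w ! (j - 1) = v} = {}"
      by (auto simp: comp_of_def simp del: Collect_empty_eq)
    then show False unfolding mem_set_positions by blast
  qed
  show "sorted_wrt disjnt (comp_of w)"
    unfolding comp_of_def sorted_wrt_map
    by (rule sorted_wrt_mono_rel[OF _ strict_sorted_list_of_set]) (auto simp: disjnt_def)
  show "\<Union>(set (comp_of w)) = {1..length w}"
    using positions_image[of w] by (auto simp: comp_of_def)
qed

lemma comp_of_Comps [simp]: "comp_of w \<in> Comps" "cdeg (comp_of w) = length w"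
  using CompsI is_setcomp_cdeg is_setcomp_comp_of by blast+

lemma block_index:
  assumes "is_setcomp S R" "j \<in> S"
  shows "\<exists>r<length R. j \<in> R ! r"
  using assms is_setcomp_Union by (metis UnionE in_set_conv_nth)

lemma M_eq_1_comp_of:
  assumes "\<forall>x\<in>set w. 1 \<le> x"
  shows "M (comp_of w) w = 1"
proof -
  let ?xs = "sorted_list_of_set (set w)"
  have len: "length (comp_of w) = length ?xs" by (simp add: comp_of_def)
  have nth: "j \<in> comp_of w ! r \<longleftrightarrow> j \<in> {1..length w} \<and> w ! (j - 1) = ?xs ! r" if "r < length ?xs" for j r
    using that by (simp add: comp_of_def)
  have "w ! (j - 1) = w ! (j' - 1) \<longleftrightarrow> r = s" "r < s \<longrightarrow> w ! (j - 1) < w ! (j' - 1)"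
    if "r < length ?xs" "s < length ?xs" "j \<in> comp_of w ! r" "j' \<in> comp_of w ! s" for r s j j'
    using that nth sorted_wrt_nth_less[OF strict_sorted_list_of_set[of "set w"], of r s]
      nth_eq_iff_index_eq[OF distinct_sorted_list_of_set[of "set w"], of r s]
    by simp_all
  then show ?thesis using assms by (auto simp: M_def len)
qed

text \<open>If \<open>M R\<close> does not vanish on \<open>w\<close>, then \<open>w\<close> is
  constant on each block, with letters strictly increasing along \<open>R\<close>.\<close>

lemma comp_of_eq_if_M:
  assumes R: "R \<in> Comps" and M: "M R w \<noteq> 0"
  shows "comp_of w = R"
proof -
  have len: "length w = cdeg R"
    and rel: "\<And>r s j j'. \<lbrakk>r < length R; s < length R; j \<in> R ! r; j' \<in> R ! s\<rbrakk> \<Longrightarrow>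
      (w ! (j - 1) = w ! (j' - 1) \<longleftrightarrow> r = s) \<and> (r < s \<longrightarrow> w ! (j - 1) < w ! (j' - 1))"
    using M by (auto simp: M_def split: if_splits)
  have sc: "is_setcomp {1..length w} R" using CompsD[OF R] len by simp
  define b where "b = (\<lambda>r. SOME j. j \<in> R ! r)"
  have b: "b r \<in> R ! r" if "r < length R" for r
  proof -
    have "R ! r \<noteq> {}" using sc that by (auto simp: is_setcomp_def)
    then show ?thesis unfolding b_def by (simp add: some_in_eq)
  qed
  have sub: "R ! r \<subseteq> {1..length w}" if "r < length R" for r
    using is_setcomp_Union[OF sc] nth_mem[OF that] by blast
  \<comment> \<open>The letters read off at the representatives \<open>b r\<close>. They increase
    strictly and exhaust the letters of \<open>w\<close>, so this is the sorted list underlying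
    \<open>comp_of w\<close>.\<close>
  let ?vs = "map (\<lambda>r. w ! (b r - 1)) [0..<length R]"
  have sorted: "sorted_wrt (<) ?vs"
    unfolding sorted_wrt_iff_nth_less
  proof (intro allI impI)
    fix i j assume "i < j" "j < length ?vs"
    then show "?vs ! i < ?vs ! j" using rel[of i j "b i" "b j"] b by simp
  qed
  have "set ?vs = (\<lambda>j. w ! (j - 1)) ` {1..length w}"
  proof (intro equalityI subsetI)
    fix v assume "v \<in> set ?vs"
    then obtain r where "r < length R" "v = w ! (b r - 1)" by auto
    then show "v \<in> (\<lambda>j. w ! (j - 1)) ` {1..length w}" using b sub by blast
  next
    fix v assume "v \<in> (\<lambda>j. w ! (j - 1)) ` {1..length w}"
    then obtain j where j: "j \<in> {1..length w}" "v = w ! (j - 1)" by blast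
    then obtain r where r: "r < length R" "j \<in> R ! r" using block_index[OF sc] by blast
    then have "v = w ! (b r - 1)" using rel[OF r(1) r(1) r(2) b[OF r(1)]] j by simp
    then show "v \<in> set ?vs" using r by simp
  qed
  then have "set ?vs = set w" by (simp only: positions_image)
  then have vs: "sorted_list_of_set (set w) = ?vs"
    using sorted by (intro strict_sorted_equal strict_sorted_list_of_set) auto
  have "{j \<in> {1..length w}. w ! (j - 1) = w ! (b r - 1)} = R ! r" if r: "r < length R" for r
  proof (intro equalityI subsetI)
    fix j assume j: "j \<in> {j \<in> {1..length w}. w ! (j - 1) = w ! (b r - 1)}"
    then obtain s where s: "s < length R" "j \<in> R ! s" using block_index[OF sc] by blast
    then show "j \<in> R ! r" using rel[OF s(1) r s(2) b[OF r]] j by simp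
  next
    fix j assume "j \<in> R ! r"
    then show "j \<in> {j \<in> {1..length w}. w ! (j - 1) = w ! (b r - 1)}"
      using rel[OF r r _ b[OF r]] sub[OF r] by blast
  qed
  then show ?thesis
    by (intro nth_equalityI) (simp_all add: comp_of_def vs)
qed

text \<open>Evaluation at a word thus sees a single basis series. The condition on letters reflects
  that the variables start with index 1, while lists may contain 0.\<close>

lemma M_comp_of:
  assumes "R \<in> Comps"
  shows "M R w = (if (\<forall>x\<in>set w. 1 \<le> x) \<and> comp_of w = R then 1 else 0)"
proof (cases "M R w = 0")
  case True
  then show ?thesis using M_eq_1_comp_of[of w] by auto
next
  case False
  then have "M R w = 1" "\<forall>j<length w. 1 \<le> w ! j" by (auto simp: M_def split: if_splits)
  then show ?thesis using comp_of_eq_if_M[OF assms False] by (simp add: all_set_conv_all_nth)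
qed

lemma comp_of_surj:
  assumes R: "R \<in> Comps"
  obtains w where "\<forall>x\<in>set w. 1 \<le> x" "comp_of w = R"
proof -
  let ?n = "cdeg R"
  define b where "b = (\<lambda>j. SOME r. r < length R \<and> j \<in> R ! r)"
  \<comment> \<open>The letter at a position is the index of its block, raised by one to be a valid
    variable; \<open>Suc i\<close> turns the list index into a position.\<close>
  define w where "w = map (\<lambda>i. Suc (b (Suc i))) [0..<?n]"
  have sc: "is_setcomp {1..?n} R" using CompsD[OF R] .
  have b_eq: "b j = r" if r: "r < length R" "j \<in> R ! r" for j r
  proof -
    have "b j < length R \<and> j \<in> R ! b j"
      unfolding b_def by (rule someI[of "\<lambda>r. r < length R \<and> j \<in> R ! r"]) (use r in simp)
    then show ?thesis using sc r unfolding is_setcomp_def by (metis IntI empty_iff)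
  qed
  have w_nth: "w ! (j - 1) = Suc r" if r: "r < length R" "j \<in> R ! r" for j r
  proof -
    have "j \<in> {1..?n}" using is_setcomp_Union[OF sc] nth_mem[OF r(1)] r(2) by blast
    then obtain i where "j = Suc i" "i < ?n" by (cases j) auto
    then show ?thesis using b_eq[OF r] by (simp add: w_def)
  qed
  have "M R w = 1"
    using w_nth by (auto simp: M_def w_def)
  then have "comp_of w = R" using comp_of_eq_if_M[OF R] by simp
  moreover have "\<forall>x\<in>set w. 1 \<le> x" by (auto simp: w_def)
  ultimately show thesis using that by blast
qed

text \<open>Letters of a factor keep their order and its positions are merely shifted by
  \<open>a\<close>; the blocks that become empty are those of letters missing from the factor.
  Prefixes and suffixes are both instances.\<close>

lemma restr_comp_of:
  assumes "a + m \<le> length w"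
  shows "restr (comp_of w) {a + 1..a + m} = comp_of (take m (drop a w))"
proof -
  let ?u = "take m (drop a w)" and ?I = "{a + 1..a + m}" and ?k = "\<lambda>x. x - a"
  let ?B = "\<lambda>v. {j \<in> {1..length w}. w ! (j - 1) = v}"
  have len: "length ?u = m" using assms by simp
  have k: "strict_mono_on ?I ?k" "?k ` ?I = {1..card ?I}"
    by (auto simp: strict_mono_on_def image_iff intro!: bexI[of _ "_ + a"])
  have nth: "?u ! (j - 1) = w ! (j + a - 1)" if "j \<in> {1..m}" for j
    using that assms by (cases j) (simp_all add: add.commute)
  have blk: "?k ` (?B v \<inter> ?I) = {j \<in> {1..length ?u}. ?u ! (j - 1) = v}" for v
  proof (intro equalityI subsetI)
    fix j assume "j \<in> ?k ` (?B v \<inter> ?I)"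
    then obtain i where "i \<in> ?I" "w ! (i - 1) = v" "j = i - a" by blast
    then show "j \<in> {j \<in> {1..length ?u}. ?u ! (j - 1) = v}"
      using nth[of j] len by auto
  next
    fix j assume "j \<in> {j \<in> {1..length ?u}. ?u ! (j - 1) = v}"
    then have "j \<in> {1..m}" "w ! (j + a - 1) = v" using nth[of j] len by auto
    then show "j \<in> ?k ` (?B v \<inter> ?I)"
      using assms by (intro image_eqI[of _ _ "j + a"]) auto
  qed
  have ne: "?B v \<inter> ?I \<noteq> {} \<longleftrightarrow> v \<in> set ?u" for v
  proof -
    have "?B v \<inter> ?I \<noteq> {} \<longleftrightarrow> {j \<in> {1..length ?u}. ?u ! (j - 1) = v} \<noteq> {}"
      unfolding blk[symmetric] by simp
    also have "\<dots> \<longleftrightarrow> v \<in> set ?u" by (rule mem_set_positions[symmetric])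
    finally show ?thesis .
  qed
  have sub: "set ?u \<subseteq> set w" by (meson in_set_dropD in_set_takeD subsetI)
  \<comment> \<open>Filtering keeps a list strictly sorted, and a strictly sorted list is determined
    by its set.\<close>
  have srt: "filter (\<lambda>v. v \<in> set ?u) (sorted_list_of_set (set w)) = sorted_list_of_set (set ?u)"
    by (rule strict_sorted_equal)
      (use sub strict_sorted_list_of_set[of "set w"] in \<open>auto simp: sorted_wrt_filter\<close>)
  have "restr (comp_of w) ?I = relabel ?k (trace (comp_of w) ?I)"
    using k by (intro restr_relabel_trace) auto
  also have "trace (comp_of w) ?I =
      map (\<lambda>v. ?B v \<inter> ?I) (filter (\<lambda>v. ?B v \<inter> ?I \<noteq> {}) (sorted_list_of_set (set w)))"
    by (simp add: trace_def comp_of_def filter_map o_def)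
  also have "\<dots> = map (\<lambda>v. ?B v \<inter> ?I) (sorted_list_of_set (set ?u))"
    by (simp only: ne srt)
  also have "relabel ?k \<dots> = map (\<lambda>v. ?k ` (?B v \<inter> ?I)) (sorted_list_of_set (set ?u))"
    by simp
  also have "\<dots> = comp_of ?u"
    unfolding blk comp_of_def ..
  finally show ?thesis .
qed

lemma restr_comp_of_take: "p \<le> length w \<Longrightarrow> restr (comp_of w) {1..p} = comp_of (take p w)"
  using restr_comp_of[of 0 p w] by simp

lemma restr_comp_of_drop: "p \<le> length w \<Longrightarrow> restr (comp_of w) {p + 1..length w} = comp_of (drop p w)"
  using restr_comp_of[of p "length w - p" w] by simp

section \<open>The product of NCQsym in the basis of the series \<open>M\<close>\<close>

text \<open>Counterpart of \<open>glued\<close> with a cut of the positions instead of the blocks: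
  the terms of the product of \<open>M P\<close> and \<open>M Q\<close>, in which blocks of
  \<open>P\<close> and of shifted \<open>Q\<close> may interleave or merge.\<close>

definition unglued :: "scomp \<Rightarrow> scomp \<Rightarrow> scomp set" where
  "unglued P Q = {R \<in> Comp (cdeg P + cdeg Q).
     restr R {1..cdeg P} = P \<and> restr R {cdeg P + 1..cdeg R} = Q}"

lemma finite_unglued: "finite (unglued P Q)"
  unfolding unglued_def using finite_Comp by simp

lemma ncq_of_comp_of:
  assumes "Poly_Mapping.keys y \<subseteq> Comps"
  shows "ncq_of y w = (if \<forall>x\<in>set w. 1 \<le> x then poly_mapping.lookup y (comp_of w) else 0)"
proof -
  have "ncq_of y w = (\<Sum>R\<in>Poly_Mapping.keys y.
      if comp_of w = R then (if \<forall>x\<in>set w. 1 \<le> x then poly_mapping.lookup y R else 0) else 0)"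
    unfolding ncq_of_def using assms by (intro sum.cong refl) (auto simp: M_comp_of subset_iff)
  then show ?thesis by (simp add: in_keys_iff)
qed

lemma lookup_sum_frag_of:
  assumes "finite A"
  shows "poly_mapping.lookup (\<Sum>R\<in>A. frag_of R) S = (if S \<in> A then 1 else 0)"
  using assms by (simp add: lookup_sum)

text \<open>\<open>M P\<close> is homogeneous of degree \<open>cdeg P\<close>, so a single cut of
  \<open>w\<close> survives. It restricts \<open>comp_of w\<close> to the two segments on which
  \<open>unglued\<close> imposes its conditions.\<close>

lemma ser_mult_M:
  assumes P: "P \<in> Comps" and Q: "Q \<in> Comps"
  shows "ser_mult (M P) (M Q) w = (if (\<forall>x\<in>set w. 1 \<le> x) \<and> comp_of w \<in> unglued P Q then 1 else 0)"
proof -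
  let ?p = "cdeg P"
  have "ser_mult (M P) (M Q) w =
      (\<Sum>i\<le>length w. if i = ?p then M P (take ?p w) * M Q (drop ?p w) else 0)"
    unfolding ser_mult_def
  proof (intro sum.cong refl)
    fix i assume "i \<in> {..length w}"
    then have "M P (take i w) = 0" if "i \<noteq> ?p" using that by (simp add: M_def)
    then show "M P (take i w) * M Q (drop i w) =
        (if i = ?p then M P (take ?p w) * M Q (drop ?p w) else 0)" by simp
  qed
  also have "\<dots> = (if ?p \<le> length w then M P (take ?p w) * M Q (drop ?p w) else 0)"
    by simp
  also have "\<dots> = (if (\<forall>x\<in>set w. 1 \<le> x) \<and> comp_of w \<in> unglued P Q then 1 else 0)"
  proof (cases "?p \<le> length w")
    case False
    then show ?thesis by (simp add: unglued_def Comp_iff)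
  next
    case True
    have "(\<forall>x\<in>set (take ?p w). 1 \<le> x) \<and> (\<forall>x\<in>set (drop ?p w). 1 \<le> x) \<longleftrightarrow> (\<forall>x\<in>set w. 1 \<le> x)"
      by (metis (no_types) Un_iff append_take_drop_id set_append)
    moreover have "comp_of (take ?p w) = P \<and> comp_of (drop ?p w) = Q \<longleftrightarrow> comp_of w \<in> unglued P Q"
    proof
      assume *: "comp_of (take ?p w) = P \<and> comp_of (drop ?p w) = Q"
      then have "cdeg Q = length w - ?p" using comp_of_Comps(2)[of "drop ?p w"] by simp
      then show "comp_of w \<in> unglued P Q"
        using * True restr_comp_of_take[OF True] restr_comp_of_drop[OF True]
        by (simp add: unglued_def Comp_iff)
    next
      assume "comp_of w \<in> unglued P Q"
      then show "comp_of (take ?p w) = P \<and> comp_of (drop ?p w) = Q"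
        using restr_comp_of_take[OF True] restr_comp_of_drop[OF True] by (simp add: unglued_def)
    qed
    ultimately show ?thesis
      using True by (auto simp: M_comp_of[OF P] M_comp_of[OF Q])
  qed
  finally show ?thesis .
qed

text \<open>Linear independence: each \<open>M R\<close> has a word on which no other basis series
  is nonzero, and evaluating there returns the coefficient of \<open>R\<close>.\<close>

lemma ncq_of_inj:
  assumes x: "Poly_Mapping.keys x \<subseteq> Comps" and y: "Poly_Mapping.keys y \<subseteq> Comps"
    and eq: "ncq_of x = ncq_of y"
  shows "x = y"
proof (rule poly_mapping_eqI)
  fix R
  show "poly_mapping.lookup x R = poly_mapping.lookup y R"
  proof (cases "R \<in> Comps")
    case True
    then obtain w where "\<forall>x\<in>set w. 1 \<le> x" "comp_of w = R" by (rule comp_of_surj)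
    then show ?thesis
      using fun_cong[OF eq, of w] ncq_of_comp_of[OF x] ncq_of_comp_of[OF y] by simp
  next
    case False
    then have "R \<notin> Poly_Mapping.keys x" "R \<notin> Poly_Mapping.keys y" using x y by blast+
    then show ?thesis by (simp add: in_keys_iff)
  qed
qed

text \<open>The definite description in \<open>prod_coeff\<close> is met by the sum over
  \<open>unglued P Q\<close>, and linear independence makes it unique.\<close>

lemma prod_coeff_unglued:
  assumes P: "P \<in> Comps" and Q: "Q \<in> Comps"
  shows "prod_coeff P Q R = (if R \<in> unglued P Q then 1 else 0)"
proof -
  let ?y = "\<Sum>R\<in>unglued P Q. frag_of R"
  have "Poly_Mapping.keys ?y \<subseteq> unglued P Q"
    using keys_sum_frag_of[of "\<lambda>R. R"] by simp
  also have "unglued P Q \<subseteq> Comps" by (auto simp: unglued_def Comp_iff)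
  finally have keys: "Poly_Mapping.keys ?y \<subseteq> Comps" .
  have "ncq_of ?y = ser_mult (M P) (M Q)"
    by (rule ext) (simp add: ncq_of_comp_of[OF keys] ser_mult_M[OF P Q] lookup_sum_frag_of finite_unglued)
  then have "(THE y. Poly_Mapping.keys y \<subseteq> Comps \<and> ncq_of y = ser_mult (M P) (M Q)) = ?y"
    using keys ncq_of_inj by (intro the_equality) auto
  then show ?thesis
    by (simp add: prod_coeff_def lookup_sum_frag_of finite_unglued)
qed

section \<open>Structure maps of the graded dual and the isomorphism\<close>

text \<open>For fixed \<open>R\<close>, a pair with \<open>R\<close> in \<open>unglued P Q\<close>
  is determined by \<open>cdeg P\<close>, and every cut of the ground set of \<open>R\<close> yields
  such a pair.\<close>

lemma dual_delta_W:
  assumes R: "R \<in> Comps"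
  shows "dual_delta (W R) =
    (\<Sum>p\<in>{0..cdeg R}. frag_of (W (restr R {1..p}), W (restr R {p + 1..cdeg R})))"
proof -
  let ?n = "cdeg R"
  let ?Y = "{(P, Q). P \<in> Comps \<and> Q \<in> Comps \<and> cdeg P + cdeg Q = ?n}"
  let ?r = "\<lambda>p. (restr R {1..p}, restr R {p + 1..?n})"
  \<comment> \<open>A sum over an infinite index set would be 0 by convention, so finiteness has to
    be secured.\<close>
  have fin: "finite ?Y"
  proof (rule finite_subset)
    show "?Y \<subseteq> (\<Union>p\<in>{0..?n}. Comp p) \<times> (\<Union>p\<in>{0..?n}. Comp p)"
      by (auto simp: Comp_iff)
  qed (use finite_Comp in blast)
  have deg: "cdeg (restr R {1..p}) = p" "cdeg (restr R {p + 1..?n}) = ?n - p" if "p \<le> ?n" for p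
    using restr_Comps(2)[OF R, of "{1..p}"] restr_Comps(2)[OF R, of "{p + 1..?n}"] that by auto
  have mem: "restr R {1..p} \<in> Comps" "restr R {p + 1..?n} \<in> Comps" if "p \<le> ?n" for p
    using restr_Comps(1)[OF R, of "{1..p}"] restr_Comps(1)[OF R, of "{p + 1..?n}"] that by auto
  have "{(P, Q) \<in> ?Y. R \<in> unglued P Q} = ?r ` {0..?n}"
  proof (intro equalityI subsetI)
    fix x assume "x \<in> {(P, Q) \<in> ?Y. R \<in> unglued P Q}"
    then obtain P Q where "x = (P, Q)" "R \<in> unglued P Q" "cdeg P + cdeg Q = ?n" by auto
    then have "x = ?r (cdeg P)" "cdeg P \<in> {0..?n}" by (auto simp: unglued_def)
    then show "x \<in> ?r ` {0..?n}" by blast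
  next
    fix x assume "x \<in> ?r ` {0..?n}"
    then obtain p where "p \<le> ?n" "x = ?r p" by auto
    then show "x \<in> {(P, Q) \<in> ?Y. R \<in> unglued P Q}"
      using deg[of p] mem[of p] R by (auto simp: unglued_def Comp_iff)
  qed
  moreover have "inj_on ?r {0..?n}"
    using deg by (intro inj_on_inverseI[of _ "\<lambda>x. cdeg (fst x)"]) simp
  moreover have "dual_delta (W R) = (\<Sum>(P, Q)\<in>?Y. if R \<in> unglued P Q then frag_of (W P, W Q) else 0)"
    unfolding dual_delta_def dualW.case
    by (intro sum.cong refl) (auto simp: prod_coeff_unglued)
  moreover have "\<dots> = (\<Sum>(P, Q)\<in>{(P, Q) \<in> ?Y. R \<in> unglued P Q}. frag_of (W P, W Q))"
    using fin by (intro sum.mono_neutral_cong_right) (auto split: if_splits)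
  ultimately show ?thesis by (simp add: sum.reindex)
qed

text \<open>Standardization preserves the number of blocks, so only the cut after
  \<open>length P\<close> blocks can produce \<open>(P, Q)\<close>; hence the coefficient is at most
  1.\<close>

lemma lookup_ncq_delta:
  "poly_mapping.lookup (ncq_delta R) (P, Q) =
    (if std (take (length P) R) = P \<and> std (drop (length P) R) = Q then 1 else 0)"
proof -
  let ?c = "\<lambda>i. std (take i R) = P \<and> std (drop i R) = Q"
  have len: "i = length P" if "?c i" "i \<le> length R" for i
    using length_std[of "take i R"] that by simp
  have "poly_mapping.lookup (ncq_delta R) (P, Q) = (\<Sum>i\<le>length R. if ?c i then 1 else 0)"
    by (auto simp: ncq_delta_def lookup_sum intro!: sum.cong)
  also have "\<dots> = (\<Sum>i\<le>length R. if i = length P then (if ?c i then 1 else 0) else 0)"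
    using len by (intro sum.cong) auto
  also have "\<dots> = (if length P \<le> length R \<and> ?c (length P) then 1 else 0)"
    by simp
  also have "\<dots> = (if ?c (length P) then 1 else 0)"
    using length_std[of "take (length P) R"] by (auto simp del: length_std)
  finally show ?thesis .
qed

lemma dual_mult_W: "dual_mult (W P) (W Q) = (\<Sum>R\<in>glued P Q. frag_of (W R))"
proof -
  have "dual_mult (W P) (W Q) =
      (\<Sum>R\<in>Comp (cdeg P + cdeg Q). if R \<in> glued P Q then frag_of (W R) else 0)"
    by (auto simp: dual_mult_def lookup_ncq_delta glued_def intro!: sum.cong)
  also have "\<dots> = (\<Sum>R\<in>glued P Q. frag_of (W R))"
    using finite_Comp by (intro sum.mono_neutral_cong_right) (auto simp: glued_def)
  finally show ?thesis .
qed

lemma frag_extend_bij_betw: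
  assumes bij: "bij_betw h A B"
  shows "bij_betw (frag_extend (\<lambda>a. frag_of (h a)))
    {x. Poly_Mapping.keys x \<subseteq> A} {y. Poly_Mapping.keys y \<subseteq> B}"
proof (rule bij_betw_byWitness[where f' = "frag_extend (\<lambda>b. frag_of (inv_into A h b))"])
  show "\<forall>x\<in>{x. Poly_Mapping.keys x \<subseteq> A}.
      frag_extend (\<lambda>b. frag_of (inv_into A h b)) (frag_extend (\<lambda>a. frag_of (h a)) x) = x"
  proof
    fix x :: "'a \<Rightarrow>\<^sub>0 int" assume "x \<in> {x. Poly_Mapping.keys x \<subseteq> A}"
    then have "frag_extend (\<lambda>a. frag_of (inv_into A h (h a))) x = frag_extend frag_of x"
      using bij by (intro frag_extend_eq) (auto simp: bij_betw_inv_into_left)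
    then show "frag_extend (\<lambda>b. frag_of (inv_into A h b)) (frag_extend (\<lambda>a. frag_of (h a)) x) = x"
      by (simp add: frag_extend_frag_extend frag_expansion[symmetric])
  qed
  show "\<forall>y\<in>{y. Poly_Mapping.keys y \<subseteq> B}.
      frag_extend (\<lambda>a. frag_of (h a)) (frag_extend (\<lambda>b. frag_of (inv_into A h b)) y) = y"
  proof
    fix y :: "'b \<Rightarrow>\<^sub>0 int" assume "y \<in> {y. Poly_Mapping.keys y \<subseteq> B}"
    then have "frag_extend (\<lambda>b. frag_of (h (inv_into A h b))) y = frag_extend frag_of y"
      using bij by (intro frag_extend_eq) (auto simp: bij_betw_inv_into_right)
    then show "frag_extend (\<lambda>a. frag_of (h a)) (frag_extend (\<lambda>b. frag_of (inv_into A h b)) y) = y"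
      by (simp add: frag_extend_frag_extend frag_expansion[symmetric])
  qed
  show "frag_extend (\<lambda>a. frag_of (h a)) ` {x. Poly_Mapping.keys x \<subseteq> A} \<subseteq> {y. Poly_Mapping.keys y \<subseteq> B}"
  proof clarify
    fix x b assume "Poly_Mapping.keys x \<subseteq> A" and b: "b \<in> Poly_Mapping.keys (frag_extend (\<lambda>a. frag_of (h a)) x)"
    then have "Poly_Mapping.keys (frag_extend (\<lambda>a. frag_of (h a)) x) \<subseteq> B"
      using bij_betwE[OF bij] by (intro keys_frag_extend_subset) auto
    then show "b \<in> B" using b by blast
  qed
  show "frag_extend (\<lambda>b. frag_of (inv_into A h b)) ` {y. Poly_Mapping.keys y \<subseteq> B} \<subseteq> {x. Poly_Mapping.keys x \<subseteq> A}"
  proof clarify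
    fix y a assume "Poly_Mapping.keys y \<subseteq> B"
      and a: "a \<in> Poly_Mapping.keys (frag_extend (\<lambda>b. frag_of (inv_into A h b)) y)"
    then have "Poly_Mapping.keys (frag_extend (\<lambda>b. frag_of (inv_into A h b)) y) \<subseteq> A"
      using bij_betwE[OF bij_betw_inv_into[OF bij]] by (intro keys_frag_extend_subset) auto
    then show "a \<in> A" using a by blast
  qed
qed

text \<open>Both products are now sums over \<open>glued P Q\<close>, and both coproducts are sums
  over the cuts of the ground set, so the structure maps agree term by term.\<close>

lemma hopf_iso_dual:
  "hopf_iso Comps [] hat_mult bar_delta t_eps
     dual_basis (W []) dual_mult dual_delta dual_eps (\<lambda>P. frag_of (W P))"
  unfolding hopf_iso_def
proof (intro conjI ballI)
  have "bij_betw W Comps dual_basis"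
    by (auto simp: bij_betw_def inj_on_def dual_basis_def)
  then show "bij_betw (frag_extend (\<lambda>P. frag_of (W P))) {x. Poly_Mapping.keys x \<subseteq> Comps}
      {y. Poly_Mapping.keys y \<subseteq> dual_basis}"
    by (rule frag_extend_bij_betw)
next
  fix P Q assume "P \<in> Comps" "Q \<in> Comps"
  then show "frag_extend (\<lambda>P. frag_of (W P)) (hat_mult P Q) =
      mult_ext dual_mult (frag_of (W P)) (frag_of (W Q))"
    by (simp add: hat_mult_glued dual_mult_W frag_extend_sum_of)
next
  fix R assume "R \<in> Comps"
  then show "frag_extend (\<lambda>(b, c). tens (frag_of (W b)) (frag_of (W c))) (bar_delta R) =
      frag_extend dual_delta (frag_of (W R))"
    by (simp add: bar_delta_def dual_delta_W frag_extend_sum_of)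
next
  fix P show "counit_ext dual_eps (frag_of (W P)) = t_eps P"
    by (simp add: dual_eps_def t_eps_def)
qed simp

theorem theorem2p8:
  shows "(hopf_algebra Comps [] bar_mult hat_delta t_eps \<and>
          graded_connected Comps [] bar_mult hat_delta t_eps cdeg \<and>
          cocommutative Comps hat_delta) \<and>
         (hopf_algebra Comps [] hat_mult bar_delta t_eps \<and>
          graded_connected Comps [] hat_mult bar_delta t_eps cdeg \<and>
          hopf_iso Comps [] hat_mult bar_delta t_eps
                   dual_basis (W []) dual_mult dual_delta dual_eps
                   (\<lambda>P. frag_of (W P)))"
  using graded_connected_bialgebra.hopf_algebra[OF bialgebra_bar_hat]
    graded_connected_bialgebra.graded_connected[OF bialgebra_bar_hat] cocommutative_hat_delta
    graded_connected_bialgebra.hopf_algebra[OF bialgebra_hat_bar]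
    graded_connected_bialgebra.graded_connected[OF bialgebra_hat_bar] hopf_iso_dual
  by (intro conjI)

end
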